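(* There is a constant $C>0$ such that for every normalised $\tilde f\in L^2(\mathbb R_+)$ whose inverse Fourier transform $f$ exists and is integrable, \[ \bar N[f]\le C\int_0^\infty\frac{dp}{2p}\,\frac{|\tilde f(p)|^2}{1-e^{-2\pi p}},\qquad \big|\bar N[f]-\bar N^{Th}_{2\pi}[f]\big|\le C\int_0^\infty\frac{dp}{2p}\,\frac{|\tilde f(p)|^2}{1-e^{-2\pi p}}.\]
   Context: $L^2(\mathbb R_+)$ is the space of functions $\tilde f$ on $\mathbb R$ vanishing for $p<0$; $\tilde f$ is normalised if $\int_0^\infty\frac{dp}{2p}|\tilde f(p)|^2=1$. Fourier transforms: $\tilde g(p)=(2\pi)^{-1/2}\int g(y)e^{-ipy}dy$. With $x(y)=-\log(1+e^{-y})$, $\widetilde{\check f}(-k)=(2\pi)^{-1/2}\int_{\mathbb R} f(y)e^{ikx(y)}dy$; $\bar N[f]=\int_0^\infty\frac{dk}{2k}|\widetilde{\check f}(-k)|^2$; $\bar N^{Th}_{\beta}[f]=\int_0^\infty\frac{dp}{2p}\frac{|\tilde f(p)|^2}{e^{\beta p}-1}$. *)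

theory Defs
  imports "HOL-Analysis.Analysis"
begin

definition FT :: "(real \<Rightarrow> complex) \<Rightarrow> real \<Rightarrow> complex" where
  "FT f p = complex_of_real (1 / sqrt (2 * pi)) *
     (\<integral> y. f y * exp (- \<i> * complex_of_real (p * y)) \<partial>lborel)"

definition xmap :: "real \<Rightarrow> real" where
  "xmap y = - ln (1 + exp (- y))"

text \<open>checkFT f k is the quantity written tilde(check f)(-k) in the paper:
  (2 pi)^(-1/2) int f(y) e^(i k x(y)) dy.\<close>
definition checkFT :: "(real \<Rightarrow> complex) \<Rightarrow> real \<Rightarrow> complex" where
  "checkFT f k = complex_of_real (1 / sqrt (2 * pi)) *
     (\<integral> y. f y * exp (\<i> * complex_of_real (k * xmap y)) \<partial>lborel)"

definition Nbar :: "(real \<Rightarrow> complex) \<Rightarrow> ennreal" where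
  "Nbar f = (\<integral>\<^sup>+ k \<in> {0<..}. ennreal ((cmod (checkFT f k))\<^sup>2 / (2 * k)) \<partial>lborel)"

definition NTh :: "real \<Rightarrow> (real \<Rightarrow> complex) \<Rightarrow> ennreal" where
  "NTh \<beta> f = (\<integral>\<^sup>+ p \<in> {0<..}.
      ennreal ((cmod (FT f p))\<^sup>2 / (2 * p) / (exp (\<beta> * p) - 1)) \<partial>lborel)"

definition Bnd :: "(real \<Rightarrow> complex) \<Rightarrow> ennreal" where
  "Bnd f = (\<integral>\<^sup>+ p \<in> {0<..}.
      ennreal ((cmod (FT f p))\<^sup>2 / (2 * p) / (1 - exp (- 2 * pi * p))) \<partial>lborel)"

definition normalised :: "(real \<Rightarrow> complex) \<Rightarrow> bool" where
  "normalised f \<longleftrightarrow>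
     (\<integral>\<^sup>+ p \<in> {0<..}. ennreal ((cmod (FT f p))\<^sup>2 / (2 * p)) \<partial>lborel) = 1"

end

theory Submission
  imports Defs "HOL-Probability.Probability" "HOL-Real_Asymp.Real_Asymp"
begin

text \<open>Since \<open>1 / (exp t - 1) \<le> 1 / (1 - exp (- t))\<close>, the thermal quantity is at most \<^term>\<open>Bnd f\<close>, so
  only \<open>Nbar f \<le> C * Bnd f\<close> matters. Up to constants \<^term>\<open>Nbar f\<close> is bounded by the squared homogeneous
  Sobolev norm of order \<open>-1/2\<close> of the push-forward of \<open>f\<close> under \<^term>\<open>xmap\<close>, i.e. by the order \<open>1/2\<close>
  Gagliardo energy (a double integral) of its primitive \<open>G\<close>. Because \<open>f\<close> has mean zero, \<open>G\<close> vanishes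
  on \<open>[0, \<infinity>)\<close>. Substituting \<open>x = xmap y\<close> on the negative half-line, the kernel
  \<open>xmap' y * xmap' z / (xmap y - xmap z)\<^sup>2\<close> is dominated by \<open>9 / (y - z)\<^sup>2\<close>, which gives the
  energy of the primitive \<open>g\<close> of \<open>f\<close>; the interaction with \<open>[0, \<infinity>)\<close> is a Hardy term bounded by
  the squared \<open>L\<^sup>2\<close> norm of \<open>g\<close>. On the Fourier side these are the integrals of \<open>|FT f p|\<^sup>2\<close> against
  \<open>1 / p\<close> and \<open>1 / p\<^sup>2\<close>, and both weights are \<open>O(1 / (p (1 - exp (- 2 \<pi> p))))\<close>.

  As \<open>f\<close> is only integrable, Plancherel is applied to the increments \<open>G (x + h) - G x\<close>, which are
  integrable, bounded and continuous.\<close>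

section \<open>Oscillatory integrals along a map \<open>\<xi>\<close>, and Fubini for bounded
  kernels\<close>

text \<open>The unnormalised Fourier transform, with sign \<open>+\<i>\<close>, of the push-forward
  of \<open>f y dy\<close> under \<open>\<xi>\<close>. The identity gives \<open>FT\<close> at
  \<open>- p\<close> and \<open>xmap\<close> gives \<open>checkFT\<close>, so both sides of the
  estimate are handled by the same lemmas, and the push-forward never has to be written as a
  function.\<close>

definition ctrans :: "(real \<Rightarrow> real) \<Rightarrow> (real \<Rightarrow> complex) \<Rightarrow> real \<Rightarrow> complex" where
  "ctrans \<xi> f k = (\<integral>y. f y * cis (k * \<xi> y) \<partial>lborel)"

lemma integrable_mult_bounded:
  fixes f g :: "real \<Rightarrow> complex"
  assumes f: "integrable lborel f" and [measurable]: "g \<in> borel_measurable borel"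
    and b: "\<And>x. norm (g x) \<le> B"
  shows "integrable lborel (\<lambda>x. f x * g x)"
proof (rule Bochner_Integration.integrable_bound)
  show "integrable lborel (\<lambda>x. B * norm (f x))"
    using f by auto
  have [measurable]: "f \<in> borel_measurable borel" using f by auto
  show "(\<lambda>x. f x * g x) \<in> borel_measurable lborel" by measurable
  have "norm (f x * g x) \<le> norm (B * norm (f x))" for x
    using mult_left_mono[OF b[of x], of "norm (f x)"] order_trans[OF norm_ge_zero b[of x]]
    by (simp add: norm_mult abs_mult mult.commute)
  then show "AE x in lborel. norm (f x * g x) \<le> norm (B * norm (f x))" by auto
qed

lemma cnj_measurable [measurable]: "cnj \<in> borel_measurable borel"
  by (intro borel_measurable_continuous_onI continuous_intros)

lemma norm_ctrans_le: "norm (ctrans \<xi> f k) \<le> (\<integral>y. norm (f y) \<partial>lborel)"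
proof -
  have "norm (ctrans \<xi> f k) \<le> (\<integral>y. norm (f y * cis (k * \<xi> y)) \<partial>lborel)"
    unfolding ctrans_def by (rule integral_norm_bound)
  then show ?thesis by (simp add: norm_mult)
qed

lemma continuous_ctrans:
  assumes f: "integrable lborel f" and [measurable]: "\<xi> \<in> borel_measurable borel"
  shows "continuous_on UNIV (ctrans \<xi> f)"
proof -
  have [measurable]: "f \<in> borel_measurable borel" using f by auto
  have "isCont (ctrans \<xi> f) k" for k
    unfolding continuous_at_sequentially comp_def
  proof (intro allI impI)
    fix X assume X: "X \<longlonglongrightarrow> k"
    show "(\<lambda>n. ctrans \<xi> f (X n)) \<longlonglongrightarrow> ctrans \<xi> f k"
      unfolding ctrans_def
    proof (rule integral_dominated_convergence[where w="\<lambda>y. norm (f y)"])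
      show "AE y in lborel. (\<lambda>n. f y * cis (X n * \<xi> y)) \<longlonglongrightarrow> f y * cis (k * \<xi> y)"
        by (intro AE_I2 tendsto_intros X)
    qed (use f in \<open>auto simp: norm_mult cis_conv_exp\<close>)
  qed
  then show ?thesis by (simp add: continuous_at_imp_continuous_on)
qed

lemma ctrans_measurable [measurable]:
  assumes "integrable lborel f" "\<xi> \<in> borel_measurable borel"
  shows "ctrans \<xi> f \<in> borel_measurable borel"
  using continuous_ctrans[OF assms] by (rule borel_measurable_continuous_onI)

text \<open>The double integrand is dominated by \<open>B * norm (f x) * norm (g y)\<close>, which
  is integrable on the product, so Fubini applies. The kernels of interest are the unimodular
  \<open>cis (k * x)\<close>.\<close>

lemma integral_swap_bounded_kernel:
  fixes f g :: "real \<Rightarrow> complex" and K :: "real \<Rightarrow> real \<Rightarrow> complex"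
  assumes f: "integrable lborel f" and g: "integrable lborel g"
    and K [measurable]: "case_prod K \<in> borel_measurable (borel \<Otimes>\<^sub>M borel)"
    and b: "\<And>x y. norm (K x y) \<le> B"
  shows "(\<integral>x. f x * (\<integral>y. g y * K x y \<partial>lborel) \<partial>lborel) =
    (\<integral>y. g y * (\<integral>x. f x * K x y \<partial>lborel) \<partial>lborel)"
proof -
  have [measurable]: "f \<in> borel_measurable borel" "g \<in> borel_measurable borel"
    using f g by auto
  have i1: "integrable lborel (\<lambda>y. g y * K x y)" for x
    by (intro integrable_mult_bounded[OF g _ b]) measurable
  have B0: "0 \<le> B" using order_trans[OF norm_ge_zero b] .
  have "integrable (lborel \<Otimes>\<^sub>M lborel) (\<lambda>(x, y). f x * (g y * K x y))"
  proof (rule lborel_pair.Fubini_integrable)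
    show "AE x in lborel. integrable lborel (\<lambda>y. case (x, y) of (x, y) \<Rightarrow> f x * (g y * K x y))"
      using i1 by (auto intro!: AE_I2)
    show "integrable lborel (\<lambda>x. \<integral>y. norm (case (x, y) of (x, y) \<Rightarrow> f x * (g y * K x y)) \<partial>lborel)"
    proof (rule Bochner_Integration.integrable_bound)
      show "integrable lborel (\<lambda>x. (B * (\<integral>y. norm (g y) \<partial>lborel)) * norm (f x))" using f by auto
      have "norm (\<integral>y. norm (case (x, y) of (x, y) \<Rightarrow> f x * (g y * K x y)) \<partial>lborel)
        \<le> norm ((B * (\<integral>y. norm (g y) \<partial>lborel)) * norm (f x))" for x
      proof -
        have "(\<integral>y. norm (f x * (g y * K x y)) \<partial>lborel) \<le> (\<integral>y. (B * norm (f x)) * norm (g y) \<partial>lborel)"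
        proof (rule integral_mono)
          show "integrable lborel (\<lambda>y. norm (f x * (g y * K x y)))" using i1 by auto
          show "integrable lborel (\<lambda>y. (B * norm (f x)) * norm (g y))" using g by auto
          show "norm (f x * (g y * K x y)) \<le> (B * norm (f x)) * norm (g y)" for y
            using mult_left_mono[OF b[of x y], of "norm (f x) * norm (g y)"]
            by (simp add: norm_mult mult_ac)
        qed
        then show ?thesis using B0 by (simp add: abs_mult mult_ac)
      qed
      then show "AE x in lborel. norm (\<integral>y. norm (case (x, y) of (x, y) \<Rightarrow> f x * (g y * K x y)) \<partial>lborel)
        \<le> norm ((B * (\<integral>y. norm (g y) \<partial>lborel)) * norm (f x))" by auto
    qed measurable
  qed measurable
  from lborel_pair.Fubini_integral[OF this]
  have "(\<integral>y. (\<integral>x. f x * (g y * K x y) \<partial>lborel) \<partial>lborel) = (\<integral>x. (\<integral>y. f x * (g y * K x y) \<partial>lborel) \<partial>lborel)" .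
  moreover have "(\<integral>x. f x * (g y * K x y) \<partial>lborel) = g y * (\<integral>x. f x * K x y \<partial>lborel)" for y
    by (subst integral_mult_right_zero[symmetric]) (simp add: mult_ac)
  ultimately show ?thesis by simp
qed

section \<open>Plancherel by Gaussian regularisation\<close>

text \<open>A Gaussian is its own Fourier transform: this is the characteristic function of the
  standard normal law after the substitution \<open>x = e * k\<close>. As a function of
  \<open>w\<close> the right side is \<open>2 * pi\<close> times an approximate identity of width
  \<open>e\<close>.\<close>

lemma integral_gauss_cis:
  assumes e: "e > 0"
  shows "(\<integral>k. complex_of_real (exp (- (e * k)\<^sup>2 / 2)) * cis (k * w) \<partial>lborel) =
    complex_of_real (2 * pi / e * std_normal_density (w / e))"
proof -
  have "complex_of_real (exp (- (w/e)\<^sup>2 / 2)) = char std_normal_distribution (w/e)"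
    by (simp add: char_std_normal_distribution)
  also have "\<dots> = (\<integral>x. std_normal_density x *\<^sub>R iexp ((w/e) * x) \<partial>lborel)"
    unfolding char_def by (subst integral_density) (auto simp: normal_density_nonneg)
  also have "\<dots> = e *\<^sub>R (\<integral>k. std_normal_density (0 + e * k) *\<^sub>R iexp ((w/e) * (0 + e * k)) \<partial>lborel)"
    using e by (subst lborel_integral_real_affine[where c=e and t=0]) auto
  also have "\<dots> = e *\<^sub>R (\<integral>k. complex_of_real (1 / sqrt (2*pi)) * (complex_of_real (exp (- (e * k)\<^sup>2 / 2)) * cis (k * w)) \<partial>lborel)"
    using e by (auto simp: std_normal_density_def cis_conv_exp scaleR_conv_of_real mult_ac)
  also have "\<dots> = complex_of_real (e / sqrt (2*pi)) * (\<integral>k. complex_of_real (exp (- (e * k)\<^sup>2 / 2)) * cis (k * w) \<partial>lborel)"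
    by (subst integral_mult_right_zero) (simp add: scaleR_conv_of_real)
  finally have *: "complex_of_real (exp (- (w/e)\<^sup>2 / 2)) = complex_of_real (e / sqrt (2*pi)) * (\<integral>k. complex_of_real (exp (- (e * k)\<^sup>2 / 2)) * cis (k * w) \<partial>lborel)" .
  have "complex_of_real (2 * pi / e * std_normal_density (w / e)) = complex_of_real (sqrt (2*pi) / e) * complex_of_real (exp (- (w/e)\<^sup>2 / 2))"
    unfolding std_normal_density_def of_real_mult[symmetric] of_real_eq_iff
    by (simp add: divide_simps)
  then show ?thesis unfolding * using e by (simp add: field_simps)
qed

text \<open>The damping factor makes the frequency integral absolutely convergent although
  \<open>ctrans (\<lambda>x. x) u\<close> is only known to be bounded. Inserting the definition of
  both transforms and swapping integrals turns the damped energy into the pairing of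
  \<open>u\<close> with a mollification of its conjugate.\<close>

lemma plancherel_gauss:
  fixes u :: "real \<Rightarrow> complex"
  assumes u: "integrable lborel u" and e: "e > 0"
  shows "(\<integral>k. complex_of_real (exp (- (e * k)\<^sup>2 / 2)) * (cnj (ctrans (\<lambda>x. x) u k) * ctrans (\<lambda>x. x) u k) \<partial>lborel)
    = 2 * pi * (\<integral>x. u x * (\<integral>z. std_normal_density z * cnj (u (x - e * z)) \<partial>lborel) \<partial>lborel)"
proof -
  let ?g = "\<lambda>k. complex_of_real (exp (- (e * k)\<^sup>2 / 2))"
  let ?P = "ctrans (\<lambda>x. x) u"
  have [measurable]: "u \<in> borel_measurable borel" using u by auto
  have [measurable]: "?P \<in> borel_measurable borel" using u by (intro ctrans_measurable) auto
  have "integrable lborel (\<lambda>k. std_normal_density (0 + e * k))"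
    by (rule lborel_integrable_real_affine) (use e integrable_normal_density[of 1 0] in auto)
  then have "integrable lborel (\<lambda>k. sqrt (2*pi) * std_normal_density (e * k))" by simp
  then have "integrable lborel (\<lambda>k. exp (- (e * k)\<^sup>2 / 2))"
    by (simp add: std_normal_density_def)
  then have g: "integrable lborel ?g" by (rule integrable_of_real)
  have gP: "integrable lborel (\<lambda>k. ?g k * cnj (?P k))"
    using norm_ctrans_le[of "\<lambda>x. x" u] by (intro integrable_mult_bounded[OF g]) auto
  have cu: "integrable lborel (\<lambda>y. cnj (u y))" using u by auto
  have "(\<integral>k. ?g k * (cnj (?P k) * ?P k) \<partial>lborel) = (\<integral>k. (?g k * cnj (?P k)) * (\<integral>x. u x * cis (k * x) \<partial>lborel) \<partial>lborel)"
    by (simp add: ctrans_def mult_ac)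
  \<comment> \<open>First swap, for the factor \<open>?P k\<close>; the conjugate factor is expanded
    and swapped in the same way inside, for fixed \<open>x\<close>.\<close>
  also have "\<dots> = (\<integral>x. u x * (\<integral>k. ?g k * cnj (?P k) * cis (k * x) \<partial>lborel) \<partial>lborel)"
    by (rule integral_swap_bounded_kernel[OF gP u, where B=1]) (auto simp: cis_conv_exp)
  also have "\<dots> = (\<integral>x. u x * (2 * pi * (\<integral>z. std_normal_density z * cnj (u (x - e * z)) \<partial>lborel)) \<partial>lborel)"
  proof (intro Bochner_Integration.integral_cong refl arg_cong2[where f="(*)"])
    fix x
    have "(\<integral>k. ?g k * cnj (?P k) * cis (k * x) \<partial>lborel) =
        (\<integral>k. ?g k * (\<integral>y. cnj (u y) * cis (k * (x - y)) \<partial>lborel) \<partial>lborel)"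
    proof (intro Bochner_Integration.integral_cong refl)
      fix k
      have "cnj (?P k) * cis (k * x) = (\<integral>y. cnj (u y * cis (k * y)) \<partial>lborel) * cis (k * x)"
        unfolding ctrans_def Bochner_Integration.integral_cnj ..
      also have "\<dots> = (\<integral>y. cnj (u y * cis (k * y)) * cis (k * x) \<partial>lborel)"
        by (rule integral_mult_left_zero[symmetric])
      also have "\<dots> = (\<integral>y. cnj (u y) * cis (k * (x - y)) \<partial>lborel)"
        by (intro Bochner_Integration.integral_cong refl)
           (simp add: cis_cnj cis_mult algebra_simps)
      finally show "?g k * cnj (?P k) * cis (k * x) = ?g k * (\<integral>y. cnj (u y) * cis (k * (x - y)) \<partial>lborel)"
        by (simp add: mult_ac)
    qed
    also have "\<dots> = (\<integral>y. cnj (u y) * (\<integral>k. ?g k * cis (k * (x - y)) \<partial>lborel) \<partial>lborel)"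
      by (rule integral_swap_bounded_kernel[OF g cu, where B=1]) (auto simp: cis_conv_exp)
    also have "\<dots> = (\<integral>y. cnj (u y) * complex_of_real (2 * pi / e * std_normal_density ((x - y) / e)) \<partial>lborel)"
      unfolding integral_gauss_cis[OF e] ..
    \<comment> \<open>The substitution \<open>y = x - e * z\<close> rescales the Gaussian of width
      \<open>e\<close> to the standard one.\<close>
    also have "\<dots> = e *\<^sub>R (\<integral>z. cnj (u (x + (- e) * z)) * complex_of_real (2 * pi / e * std_normal_density ((x - (x + (- e) * z)) / e)) \<partial>lborel)"
      using e by (subst lborel_integral_real_affine[where c="-e" and t=x]) auto
    also have "\<dots> = e *\<^sub>R (\<integral>z. complex_of_real (2 * pi / e) * (std_normal_density z * cnj (u (x - e * z))) \<partial>lborel)"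
      using e by (auto simp: mult_ac)
    also have "\<dots> = 2 * pi * (\<integral>z. std_normal_density z * cnj (u (x - e * z)) \<partial>lborel)"
      using e by (subst integral_mult_right_zero) (simp add: scaleR_conv_of_real)
    finally show "(\<integral>k. ?g k * cnj (?P k) * cis (k * x) \<partial>lborel) = 2 * pi * (\<integral>z. std_normal_density z * cnj (u (x - e * z)) \<partial>lborel)" .
  qed
  also have "\<dots> = 2 * pi * (\<integral>x. u x * (\<integral>z. std_normal_density z * cnj (u (x - e * z)) \<partial>lborel) \<partial>lborel)"
    by (subst integral_mult_right_zero[symmetric]) (simp add: mult_ac)
  finally show ?thesis .
qed

text \<open>Let the width tend to 0 in \<open>plancherel_gauss\<close>. On the frequency side the
  damping factors increase to 1, so monotone convergence needs no prior square integrability; on the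
  space side boundedness and continuity of \<open>u\<close> give dominated convergence.\<close>

lemma plancherel:
  fixes u :: "real \<Rightarrow> complex"
  assumes u: "integrable lborel u" and cont: "continuous_on UNIV u"
    and M: "\<And>x. norm (u x) \<le> M"
  shows "(\<integral>\<^sup>+k. ennreal ((cmod (ctrans (\<lambda>x. x) u k))\<^sup>2) \<partial>lborel) =
    ennreal (2 * pi) * (\<integral>\<^sup>+x. ennreal ((cmod (u x))\<^sup>2) \<partial>lborel)"
proof -
  let ?P = "ctrans (\<lambda>x. x) u"
  \<comment> \<open>\<open>Suc n\<close> keeps every width positive; the widths decrease, which is
    what makes the damping factors increase.\<close>
  define \<epsilon> where "\<epsilon> n = 1 / real (Suc n)" for n
  define J where "J n = (\<integral>x. u x * (\<integral>z. std_normal_density z * cnj (u (x - \<epsilon> n * z)) \<partial>lborel) \<partial>lborel)" for n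
  let ?g = "\<lambda>n k. exp (- (\<epsilon> n * k)\<^sup>2 / 2)"
  have \<epsilon>0: "\<epsilon> n > 0" for n by (simp add: \<epsilon>_def)
  have \<epsilon>lim: "\<epsilon> \<longlonglongrightarrow> 0" unfolding \<epsilon>_def by (rule LIMSEQ_Suc[OF lim_1_over_n])
  have [measurable]: "u \<in> borel_measurable borel" using u by auto
  have [measurable]: "?P \<in> borel_measurable borel" using u by (intro ctrans_measurable) auto
  have normal: "integrable lborel std_normal_density" "integral\<^sup>L lborel std_normal_density = 1"
    using integrable_normal_density[of 1 0] integral_normal_density[of 1 0] by auto
  have M0: "0 \<le> M" using order_trans[OF norm_ge_zero M] .

  \<comment> \<open>Continuity of \<open>u\<close> gives convergence of the mollification at every
    \<open>x\<close>; \<open>M\<close> times the normal density dominates.\<close>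
  have inner: "(\<lambda>n. (\<integral>z. std_normal_density z * cnj (u (x - \<epsilon> n * z)) \<partial>lborel)) \<longlonglongrightarrow> cnj (u x)" for x
  proof -
    have "(\<lambda>n. (\<integral>z. std_normal_density z * cnj (u (x - \<epsilon> n * z)) \<partial>lborel)) \<longlonglongrightarrow> (\<integral>z. std_normal_density z * cnj (u x) \<partial>lborel)"
    proof (rule integral_dominated_convergence[where w="\<lambda>z. M * std_normal_density z"])
      show "AE z in lborel. (\<lambda>n. std_normal_density z * cnj (u (x - \<epsilon> n * z))) \<longlonglongrightarrow> std_normal_density z * cnj (u x)"
      proof (intro AE_I2 tendsto_mult tendsto_const tendsto_cnj)
        fix z
        have "(\<lambda>n. x - \<epsilon> n * z) \<longlonglongrightarrow> x - 0 * z" by (intro tendsto_intros \<epsilon>lim)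
        then show "(\<lambda>n. u (x - \<epsilon> n * z)) \<longlonglongrightarrow> u x"
          using continuous_on_tendsto_compose[OF cont, of "\<lambda>n. x - \<epsilon> n * z" x sequentially] by simp
      qed
      show "AE z in lborel. norm (std_normal_density z * cnj (u (x - \<epsilon> n * z))) \<le> M * std_normal_density z" for n
        using M by (intro AE_I2) (simp add: norm_mult mult.commute[of M] mult_left_mono)
      show "integrable lborel (\<lambda>z. M * std_normal_density z)" using normal by auto
    qed measurable
    also have "(\<integral>z. std_normal_density z * cnj (u x) \<partial>lborel) = of_real (integral\<^sup>L lborel std_normal_density) * cnj (u x)"
      by (simp only: integral_mult_left_zero integral_complex_of_real)
    finally show ?thesis using normal by simp
  qed
  have inner_bound: "norm (\<integral>z. std_normal_density z * cnj (u (x - \<epsilon> n * z)) \<partial>lborel) \<le> M" for x n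
  proof -
    have "norm (\<integral>z. std_normal_density z * cnj (u (x - \<epsilon> n * z)) \<partial>lborel) \<le> (\<integral>z. M * std_normal_density z \<partial>lborel)"
    proof (rule Bochner_Integration.integral_norm_bound_integral)
      show "integrable lborel (\<lambda>z. complex_of_real (std_normal_density z) * cnj (u (x - \<epsilon> n * z)))"
        using M normal by (intro integrable_mult_bounded[where B=M]) auto
      show "integrable lborel (\<lambda>z. M * std_normal_density z)" using normal by auto
    qed (use M in \<open>simp add: norm_mult mult.commute[of M] mult_left_mono\<close>)
    then show ?thesis using normal by simp
  qed
  have "J \<longlonglongrightarrow> (\<integral>x. u x * cnj (u x) \<partial>lborel)"
    unfolding J_def
  proof (rule integral_dominated_convergence[where w="\<lambda>x. M * norm (u x)"])
    show "AE x in lborel. (\<lambda>n. u x * (\<integral>z. std_normal_density z * cnj (u (x - \<epsilon> n * z)) \<partial>lborel)) \<longlonglongrightarrow> u x * cnj (u x)"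
      by (intro AE_I2 tendsto_mult tendsto_const inner)
    show "AE x in lborel. norm (u x * (\<integral>z. std_normal_density z * cnj (u (x - \<epsilon> n * z)) \<partial>lborel)) \<le> M * norm (u x)" for n
      using inner_bound by (intro AE_I2) (simp add: norm_mult mult.commute[of M] mult_left_mono)
  qed (use u in auto)
  also have "(\<integral>x. u x * cnj (u x) \<partial>lborel) = of_real (\<integral>x. (cmod (u x))\<^sup>2 \<partial>lborel)"
    by (simp only: integral_complex_of_real[symmetric] complex_norm_square)
  finally have "(\<lambda>n. 2 * pi * Re (J n)) \<longlonglongrightarrow> 2 * pi * Re (of_real (\<integral>x. (cmod (u x))\<^sup>2 \<partial>lborel))"
    by (intro tendsto_intros tendsto_Re)
  then have limJ: "(\<lambda>n. ennreal (2 * pi * Re (J n))) \<longlonglongrightarrow> ennreal (2 * pi * (\<integral>x. (cmod (u x))\<^sup>2 \<partial>lborel))"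
    by (intro tendsto_ennrealI) simp
  have lhs: "(\<integral>\<^sup>+k. ennreal (?g n k * (cmod (?P k))\<^sup>2) \<partial>lborel) = ennreal (2 * pi * Re (J n))" for n
  proof -
    have "integrable lborel (\<lambda>k. std_normal_density (0 + \<epsilon> n * k))"
      by (rule lborel_integrable_real_affine) (use normal \<epsilon>0[of n] in auto)
    then have "integrable lborel (\<lambda>k. (sqrt (2*pi) * (\<integral>y. norm (u y) \<partial>lborel)\<^sup>2) * std_normal_density (\<epsilon> n * k))" by simp
    then have int: "integrable lborel (\<lambda>k. ?g n k * (cmod (?P k))\<^sup>2)"
    proof (rule Bochner_Integration.integrable_bound)
      have "norm (?g n k * (cmod (?P k))\<^sup>2) \<le> norm ((sqrt (2*pi) * (\<integral>y. norm (u y) \<partial>lborel)\<^sup>2) * std_normal_density (\<epsilon> n * k))" for k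
        using power_mono[OF norm_ctrans_le[of "\<lambda>x. x" u k] norm_ge_zero, of 2]
        by (simp add: std_normal_density_def abs_mult mult.commute)
      then show "AE k in lborel. norm (?g n k * (cmod (?P k))\<^sup>2) \<le> norm ((sqrt (2*pi) * (\<integral>y. norm (u y) \<partial>lborel)\<^sup>2) * std_normal_density (\<epsilon> n * k))"
        by auto
    qed measurable
    have "complex_of_real (\<integral>k. ?g n k * (cmod (?P k))\<^sup>2 \<partial>lborel) =
      (\<integral>k. complex_of_real (?g n k) * (cnj (?P k) * ?P k) \<partial>lborel)"
      unfolding integral_complex_of_real[symmetric] of_real_mult complex_norm_square
      by (simp only: mult.commute[of "cnj _"])
    also have "\<dots> = complex_of_real (2 * pi) * J n"
      unfolding J_def using plancherel_gauss[OF u \<epsilon>0[of n]] by simp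
    finally have eq: "complex_of_real (\<integral>k. ?g n k * (cmod (?P k))\<^sup>2 \<partial>lborel) = complex_of_real (2 * pi) * J n" .
    have "(\<integral>k. ?g n k * (cmod (?P k))\<^sup>2 \<partial>lborel) = Re (complex_of_real (2 * pi) * J n)"
      using arg_cong[OF eq, of Re] by (simp only: Re_complex_of_real)
    also have "\<dots> = 2 * pi * Re (J n)" by simp
    finally show ?thesis using nn_integral_eq_integral[OF int] by simp
  qed
  \<comment> \<open>Passage to the limit on the frequency side by monotone convergence.\<close>
  have "(\<lambda>n. \<integral>\<^sup>+k. ennreal (?g n k * (cmod (?P k))\<^sup>2) \<partial>lborel) \<longlonglongrightarrow> (\<integral>\<^sup>+k. ennreal ((cmod (?P k))\<^sup>2) \<partial>lborel)"
  proof (rule nn_integral_LIMSEQ)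
    show "incseq (\<lambda>n k. ennreal (?g n k * (cmod (?P k))\<^sup>2))"
    proof (intro incseq_SucI le_funI ennreal_leI mult_right_mono)
      fix n k
      have "\<epsilon> (Suc n) \<le> \<epsilon> n" by (simp add: \<epsilon>_def frac_le)
      then have "(\<epsilon> (Suc n))\<^sup>2 \<le> (\<epsilon> n)\<^sup>2" using \<epsilon>0[of "Suc n"] by (intro power_mono) auto
      then show "?g n k \<le> ?g (Suc n) k" by (simp add: power_mult_distrib mult_right_mono)
    qed simp
    have "(\<lambda>n. ?g n k * (cmod (?P k))\<^sup>2) \<longlonglongrightarrow> exp (- (0 * k)\<^sup>2 / 2) * (cmod (?P k))\<^sup>2" for k
      by (intro tendsto_intros \<epsilon>lim) auto
    then show "(\<lambda>n. ennreal (?g n k * (cmod (?P k))\<^sup>2)) \<longlonglongrightarrow> ennreal ((cmod (?P k))\<^sup>2)" for k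
      by (intro tendsto_ennrealI) simp
  qed measurable
  then have "(\<integral>\<^sup>+k. ennreal ((cmod (?P k))\<^sup>2) \<partial>lborel) = ennreal (2 * pi * (\<integral>x. (cmod (u x))\<^sup>2 \<partial>lborel))"
    unfolding lhs using limJ by (rule LIMSEQ_unique)
  also have "\<dots> = ennreal (2 * pi) * (\<integral>\<^sup>+x. ennreal ((cmod (u x))\<^sup>2) \<partial>lborel)"
  proof -
    \<comment> \<open>An integrable bounded function is square integrable, since its square is at
      most \<open>M * norm (u x)\<close>.\<close>
    have "integrable lborel (\<lambda>x. (cmod (u x))\<^sup>2)"
    proof (rule Bochner_Integration.integrable_bound)
      show "integrable lborel (\<lambda>x. M * norm (u x))" using u by auto
      show "AE x in lborel. norm ((cmod (u x))\<^sup>2) \<le> norm (M * norm (u x))"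
        using M M0 by (intro AE_I2) (simp add: power2_eq_square abs_mult mult_right_mono)
    qed measurable
    then show ?thesis by (subst nn_integral_eq_integral) (auto simp: ennreal_mult)
  qed
  finally show ?thesis .
qed

section \<open>Primitives of push-forwards and the Fourier transform of their increments\<close>

text \<open>The distribution function of the push-forward of \<open>f y dy\<close> under
  \<open>\<xi>\<close>: the primitive \<open>G\<close> for \<open>\<xi> = xmap\<close>, and the
  ordinary primitive \<open>g\<close> of \<open>f\<close> for the identity.\<close>

definition cumul :: "(real \<Rightarrow> real) \<Rightarrow> (real \<Rightarrow> complex) \<Rightarrow> real \<Rightarrow> complex" where
  "cumul \<xi> f x = (\<integral>y. f y * indicator {..x} (\<xi> y) \<partial>lborel)"

lemma integrable_cumul:
  fixes f :: "real \<Rightarrow> complex"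
  assumes "integrable lborel f" and [measurable]: "\<xi> \<in> borel_measurable borel" "A \<in> sets borel"
  shows "integrable lborel (\<lambda>y. f y * indicator A (\<xi> y))"
  using assms by (intro integrable_mult_bounded[where B=1]) (auto split: split_indicator)

text \<open>Injectivity leaves at most one \<open>y\<close> with \<open>\<xi> y = x\<close>, so the
  push-forward has no atoms: off this null set the indicators are eventually constant, and
  \<open>norm (f y)\<close> dominates.\<close>

lemma continuous_cumul:
  assumes f: "integrable lborel f" and [measurable]: "\<xi> \<in> borel_measurable borel" and inj: "inj \<xi>"
  shows "continuous_on UNIV (cumul \<xi> f)"
proof -
  have [measurable]: "f \<in> borel_measurable borel" using f by auto
  have "isCont (cumul \<xi> f) x" for x
    unfolding continuous_at_sequentially comp_def
  proof (intro allI impI)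
    fix X assume X: "X \<longlonglongrightarrow> x"
    show "(\<lambda>n. cumul \<xi> f (X n)) \<longlonglongrightarrow> cumul \<xi> f x"
      unfolding cumul_def
    proof (rule integral_dominated_convergence[where w="\<lambda>y. norm (f y)"])
      have "finite (\<xi> -` {x})" using inj by (intro finite_vimageI) auto
      then have "AE y in lborel. y \<notin> \<xi> -` {x}"
        by (intro AE_not_in finite_imp_null_set_lborel)
      then show "AE y in lborel. (\<lambda>n. f y * indicator {..X n} (\<xi> y)) \<longlonglongrightarrow> f y * indicator {..x} (\<xi> y)"
      proof (eventually_elim, intro tendsto_mult tendsto_const)
        fix y assume "y \<notin> \<xi> -` {x}"
        then consider "\<xi> y < x" | "x < \<xi> y" by fastforce
        then show "(\<lambda>n. indicator {..X n} (\<xi> y) :: complex) \<longlonglongrightarrow> indicator {..x} (\<xi> y)"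
        proof cases
          case 1
          from order_tendstoD(1)[OF X this] have "\<forall>\<^sub>F n in sequentially. indicator {..x} (\<xi> y) = (indicator {..X n} (\<xi> y) :: complex)"
            by eventually_elim (use 1 in auto)
          then show ?thesis by (rule Lim_transform_eventually[OF tendsto_const])
        next
          case 2
          from order_tendstoD(2)[OF X this] have "\<forall>\<^sub>F n in sequentially. indicator {..x} (\<xi> y) = (indicator {..X n} (\<xi> y) :: complex)"
            by eventually_elim (use 2 in auto)
          then show ?thesis by (rule Lim_transform_eventually[OF tendsto_const])
        qed
      qed
    qed (use f in \<open>auto simp: norm_mult split: split_indicator\<close>)
  qed
  then show ?thesis by (simp add: continuous_at_imp_continuous_on)
qed

lemma norm_cumul_le:
  assumes f: "integrable lborel f" and \<xi>: "\<xi> \<in> borel_measurable borel"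
  shows "norm (cumul \<xi> f x) \<le> (\<integral>y. norm (f y) \<partial>lborel)"
  unfolding cumul_def
  by (rule Bochner_Integration.integral_norm_bound_integral)
    (use f \<xi> integrable_cumul[OF f \<xi>] in \<open>auto simp: norm_mult split: split_indicator\<close>)

text \<open>The condition \<open>x < \<xi> y \<le> x + h\<close> is read as a condition on
  \<open>x\<close>. The increment thus becomes a superposition of indicators of intervals of length
  \<open>h\<close>, ready for Fubini.\<close>

lemma cumul_diff:
  assumes f: "integrable lborel f" and \<xi>: "\<xi> \<in> borel_measurable borel" and h: "h > 0"
  shows "cumul \<xi> f (x + h) - cumul \<xi> f x = (\<integral>y. f y * indicator {\<xi> y - h..<\<xi> y} x \<partial>lborel)"
proof -
  have "cumul \<xi> f (x + h) - cumul \<xi> f x =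
    (\<integral>y. f y * indicator {..x+h} (\<xi> y) - f y * indicator {..x} (\<xi> y) \<partial>lborel)"
    unfolding cumul_def
    by (rule Bochner_Integration.integral_diff[symmetric]; rule integrable_cumul[OF f \<xi>]) auto
  also have "\<dots> = (\<integral>y. f y * indicator {\<xi> y - h..<\<xi> y} x \<partial>lborel)"
    using h by (intro Bochner_Integration.integral_cong refl) (auto split: split_indicator)
  finally show ?thesis .
qed

lemma integral_cis_interval:
  assumes h: "h > 0" and k: "k \<noteq> 0"
  shows "(\<integral>x. indicator {a - h..<a} x * cis (k * x) \<partial>lborel) = cis (k * a) * (1 - cis (- (k * h))) / (\<i> * of_real k)"
proof -
  have "(\<integral>x. indicator {a - h..<a} x * cis (k * x) \<partial>lborel) = (\<integral>x. indicator {a - h..a} x *\<^sub>R cis (k * x) \<partial>lborel)"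
  proof (rule integral_cong_AE)
    show "AE x in lborel. indicator {a - h..<a} x * cis (k * x) = indicator {a - h..a} x *\<^sub>R cis (k * x)"
      using AE_lborel_singleton[of a] by eventually_elim (auto split: split_indicator)
  qed (auto simp: cis_conv_exp)
  also have "\<dots> = cis (k * a) / (\<i> * of_real k) - cis (k * (a - h)) / (\<i> * of_real k)"
  proof (rule integral_FTC_Icc)
    show "continuous_on {a - h..a} (\<lambda>x. cis (k * x))" by (intro continuous_intros)
    fix x
    show "((\<lambda>x. cis (k * x) / (\<i> * of_real k)) has_vector_derivative cis (k * x)) (at x within {a - h..a})"
    proof -
      have "((\<lambda>z. exp (\<i> * (of_real k * z)) / (\<i> * of_real k)) has_field_derivative exp (\<i> * (of_real k * of_real x))) (at (of_real x))"
        using k by (auto intro!: derivative_eq_intros simp: mult_ac)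
      from has_vector_derivative_real_field[OF this] show ?thesis
        unfolding cis_conv_exp of_real_mult by (rule has_vector_derivative_at_within)
    qed
  qed (use h in auto)
  finally show ?thesis
    by (simp add: right_diff_distrib cis_mult diff_divide_distrib)
qed

text \<open>Each interval in the superposition has length \<open>h\<close>, so the double integral
  has total mass at most \<open>h\<close> times the integral of \<open>norm (f y)\<close>. Fubini
  then gives integrability, and the transform reduces to that of a single interval.\<close>

lemma
  assumes f: "integrable lborel f" and \<xi>[measurable]: "\<xi> \<in> borel_measurable borel" and h: "h > 0"
  shows integrable_increment: "integrable lborel (\<lambda>x. cumul \<xi> f (x + h) - cumul \<xi> f x)"
    and ctrans_increment: "k \<noteq> 0 \<Longrightarrow> ctrans (\<lambda>x. x) (\<lambda>x. cumul \<xi> f (x + h) - cumul \<xi> f x) k =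
      ctrans \<xi> f k * (1 - cis (- (k * h))) / (\<i> * of_real k)"
proof -
  have [measurable]: "f \<in> borel_measurable borel" using f by auto
  have [measurable]: "(\<lambda>(y, x). indicator {\<xi> y - h..<\<xi> y} x :: complex) \<in> borel_measurable (borel \<Otimes>\<^sub>M borel)"
    unfolding indicator_def atLeastLessThan_def atLeast_def lessThan_def by measurable
  have [measurable]: "(\<lambda>x. cis (k * x)) \<in> borel_measurable borel" for k
    unfolding cis_conv_exp by measurable
  have int: "integrable (lborel \<Otimes>\<^sub>M lborel) (\<lambda>(y, x). f y * (indicator {\<xi> y - h..<\<xi> y} x * cis (k * x)))" for k
  proof (rule lborel_pair.Fubini_integrable)
    have i1: "integrable lborel (\<lambda>x. indicator {\<xi> y - h..<\<xi> y} x * cis (k * x))" for y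
    proof -
      have "integrable lborel (\<lambda>x. indicator {\<xi> y - h..<\<xi> y} x :: complex)"
        using integrable_of_real[OF integrable_real_indicator[of "{\<xi> y - h..<\<xi> y}" lborel], where 'a=complex]
        using h by (simp add: of_real_indicator)
      then show ?thesis by (rule integrable_mult_bounded[where B=1]) auto
    qed
    then show "AE y in lborel. integrable lborel (\<lambda>x. case (y, x) of (y, x) \<Rightarrow> f y * (indicator {\<xi> y - h..<\<xi> y} x * cis (k * x)))"
      by auto
    have "(\<integral>x. norm (case (y, x) of (y, x) \<Rightarrow> f y * (indicator {\<xi> y - h..<\<xi> y} x * cis (k * x))) \<partial>lborel) = norm (f y) * h" for y
    proof -
      have "(\<integral>x. norm (f y * (indicator {\<xi> y - h..<\<xi> y} x * cis (k * x))) \<partial>lborel)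
        = (\<integral>x. norm (f y) * indicator {\<xi> y - h..<\<xi> y} x \<partial>lborel)"
        by (intro Bochner_Integration.integral_cong refl) (auto simp: norm_mult split: split_indicator)
      then show ?thesis using h by simp
    qed
    then show "integrable lborel (\<lambda>y. \<integral>x. norm (case (y, x) of (y, x) \<Rightarrow> f y * (indicator {\<xi> y - h..<\<xi> y} x * cis (k * x))) \<partial>lborel)"
      using f by simp
  qed measurable
  note diff = cumul_diff[OF f \<xi> h]
  \<comment> \<open>At frequency 0 the factor \<open>cis\<close> is 1 and the inner integral is the
    increment itself.\<close>
  show "integrable lborel (\<lambda>x. cumul \<xi> f (x + h) - cumul \<xi> f x)"
    unfolding diff using lborel_pair.integrable_snd[OF int[of 0]] by simp
  assume k: "k \<noteq> 0"
  have "ctrans (\<lambda>x. x) (\<lambda>x. cumul \<xi> f (x + h) - cumul \<xi> f x) k =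
      (\<integral>x. (\<integral>y. f y * (indicator {\<xi> y - h..<\<xi> y} x * cis (k * x)) \<partial>lborel) \<partial>lborel)"
    unfolding ctrans_def diff
    by (intro Bochner_Integration.integral_cong refl)
      (subst integral_mult_left_zero[symmetric], simp add: mult_ac)
  also have "\<dots> = (\<integral>y. (\<integral>x. f y * (indicator {\<xi> y - h..<\<xi> y} x * cis (k * x)) \<partial>lborel) \<partial>lborel)"
    by (rule lborel_pair.Fubini_integral[OF int])
  also have "\<dots> = (\<integral>y. (f y * cis (k * \<xi> y)) * ((1 - cis (- (k * h))) / (\<i> * of_real k)) \<partial>lborel)"
    by (intro Bochner_Integration.integral_cong refl)
      (simp add: integral_mult_right_zero integral_cis_interval[OF h k])
  also have "\<dots> = ctrans \<xi> f k * ((1 - cis (- (k * h))) / (\<i> * of_real k))"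
    unfolding ctrans_def by (rule integral_mult_left_zero)
  finally show "ctrans (\<lambda>x. x) (\<lambda>x. cumul \<xi> f (x + h) - cumul \<xi> f x) k =
      ctrans \<xi> f k * (1 - cis (- (k * h))) / (\<i> * of_real k)" by simp
qed

lemma cmod_one_minus_cis: "(cmod (1 - cis t))\<^sup>2 = 2 - 2 * cos t"
  unfolding cmod_power2 using sin_cos_squared_add[of t] by (simp add: power2_eq_square algebra_simps)

text \<open>Plancherel applies to the increment, which is integrable, continuous and bounded. The
  multiplier in its transform has squared modulus
  \<open>(2 - 2 * cos (k * h)) / k^2\<close>.\<close>

lemma parseval_increment:
  assumes f: "integrable lborel f" and \<xi>[measurable]: "\<xi> \<in> borel_measurable borel" and inj: "inj \<xi>" and h: "h > 0"
  shows "ennreal (2 * pi) * (\<integral>\<^sup>+x. ennreal ((cmod (cumul \<xi> f (x + h) - cumul \<xi> f x))\<^sup>2) \<partial>lborel) =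
    (\<integral>\<^sup>+k. ennreal ((cmod (ctrans \<xi> f k))\<^sup>2 * (2 - 2 * cos (k * h)) / k\<^sup>2) \<partial>lborel)"
proof -
  let ?U = "\<lambda>x. cumul \<xi> f (x + h) - cumul \<xi> f x"
  have "continuous_on UNIV ?U"
    by (intro continuous_intros continuous_on_compose2[OF continuous_cumul[OF f \<xi> inj]]) auto
  moreover have "norm (?U x) \<le> 2 * (\<integral>y. norm (f y) \<partial>lborel)" for x
    using norm_triangle_ineq4[of "cumul \<xi> f (x + h)" "cumul \<xi> f x"]
      norm_cumul_le[OF f \<xi>, of x] norm_cumul_le[OF f \<xi>, of "x+h"] by linarith
  ultimately have "ennreal (2 * pi) * (\<integral>\<^sup>+x. ennreal ((cmod (?U x))\<^sup>2) \<partial>lborel) =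
      (\<integral>\<^sup>+k. ennreal ((cmod (ctrans (\<lambda>x. x) ?U k))\<^sup>2) \<partial>lborel)"
    by (rule plancherel[OF integrable_increment[OF f \<xi> h], symmetric])
  also have "\<dots> = (\<integral>\<^sup>+k. ennreal ((cmod (ctrans \<xi> f k))\<^sup>2 * (2 - 2 * cos (k * h)) / k\<^sup>2) \<partial>lborel)"
  proof (rule nn_integral_cong_AE)
    show "AE k in lborel. ennreal ((cmod (ctrans (\<lambda>x. x) ?U k))\<^sup>2) =
        ennreal ((cmod (ctrans \<xi> f k))\<^sup>2 * (2 - 2 * cos (k * h)) / k\<^sup>2)"
      using AE_lborel_singleton[of 0]
    proof eventually_elim
      case (elim k)
      then show ?case
        using cmod_one_minus_cis[of "- (k * h)"]
        by (simp add: ctrans_increment[OF f \<xi> h elim] norm_mult norm_divide power_mult_distrib power_divide)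
    qed
  qed
  finally show ?thesis .
qed

section \<open>The Gagliardo energy and the square norm of a primitive on the Fourier side\<close>

text \<open>The constant linking the Gagliardo energy to the frequency weight
  \<open>1 / \<bar>k\<bar>\<close>; it enters the proof through its positivity and
  finiteness.\<close>

definition increment_mass :: ennreal where
  "increment_mass = (\<integral>\<^sup>+h. ennreal ((2 - 2 * cos h) / h\<^sup>2) * indicator {0<..} h \<partial>lborel)"

text \<open>On \<open>{pi/2..pi}\<close> the cosine is nonpositive, so the integrand is at least
  \<open>2 / pi^2\<close> there.\<close>

lemma increment_mass_pos: "0 < increment_mass"
proof -
  have "0 < ennreal (2 / pi\<^sup>2) * emeasure lborel {pi/2..pi}"
    by (auto simp: ennreal_zero_less_mult_iff)
  also have "\<dots> = (\<integral>\<^sup>+h. ennreal (2 / pi\<^sup>2) * indicator {pi/2..pi} h \<partial>lborel)"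
    by (simp add: nn_integral_cmult_indicator)
  also have "\<dots> \<le> increment_mass"
    unfolding increment_mass_def
  proof (intro nn_integral_mono)
    fix h
    have "2 / pi\<^sup>2 \<le> (2 - 2 * cos h) / h\<^sup>2" if "pi/2 \<le> h" "h \<le> pi"
    proof (intro frac_le)
      show "2 \<le> 2 - 2 * cos h" using cos_monotone_0_pi_le[of "pi/2" h] that by simp
      then show "0 \<le> 2 - 2 * cos h" by simp
      show "0 < h\<^sup>2" using that pi_gt_zero by (intro zero_less_power) linarith
      show "h\<^sup>2 \<le> pi\<^sup>2" using that pi_gt_zero by (intro power_mono) linarith+
    qed
    moreover have "0 < h" if "pi/2 \<le> h" using that pi_gt_zero by linarith
    ultimately show "ennreal (2 / pi\<^sup>2) * indicator {pi/2..pi} h \<le> ennreal ((2 - 2 * cos h) / h\<^sup>2) * indicator {0<..} h"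
      by (auto split: split_indicator intro!: ennreal_leI)
  qed
  finally show ?thesis .
qed

text \<open>Near 0 the integrand is at most 1, because
  \<open>2 - 2 * cos h = 4 * (sin (h/2))^2 \<le> h^2\<close>; beyond 1 it is at most
  \<open>4 / h^2\<close>.\<close>

lemma increment_mass_finite: "increment_mass < \<infinity>"
proof -
  have "increment_mass \<le> (\<integral>\<^sup>+h. indicator {0..1} h + ennreal (4 / h\<^sup>2) * indicator {1..} h \<partial>lborel)"
    unfolding increment_mass_def
  proof (intro nn_integral_mono)
    fix h :: real
    have eq: "2 - 2 * cos h = 4 * (sin (h/2))\<^sup>2" using cos_double_sin[of "h/2"] by simp
    have "(sin (h/2))\<^sup>2 \<le> (h/2)\<^sup>2" using abs_sin_x_le_abs_x[of "h/2"] by (simp only: abs_le_square_iff)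
    then have 1: "2 - 2 * cos h \<le> h\<^sup>2" unfolding eq by (simp add: power_divide)
    have 2: "(2 - 2 * cos h) / h\<^sup>2 \<le> 4 / h\<^sup>2"
    proof (rule divide_right_mono)
      show "2 - 2 * cos h \<le> 4" using cos_ge_minus_one[of h] by linarith
    qed simp
    have 3: "(2 - 2 * cos h) / h\<^sup>2 \<le> 1" using 1 by (auto simp: divide_le_eq_1)
    show "ennreal ((2 - 2 * cos h) / h\<^sup>2) * indicator {0<..} h \<le> indicator {0..1} h + ennreal (4 / h\<^sup>2) * indicator {1..} h"
    proof (cases "h \<le> 1")
      case True
      then have "ennreal ((2 - 2 * cos h) / h\<^sup>2) * indicator {0<..} h \<le> indicator {0..1} h"
        using ennreal_leI[OF 3] by (auto split: split_indicator)
      then show ?thesis by (rule add_increasing2[rotated]) simp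
    next
      case False
      then have "ennreal ((2 - 2 * cos h) / h\<^sup>2) * indicator {0<..} h \<le> ennreal (4 / h\<^sup>2) * indicator {1..} h"
        using ennreal_leI[OF 2] by (auto split: split_indicator)
      then show ?thesis by (rule add_increasing[rotated]) simp
    qed
  qed
  also have "\<dots> = (\<integral>\<^sup>+h. indicator {0..1::real} h \<partial>lborel) + (\<integral>\<^sup>+h. ennreal (4 / h\<^sup>2) * indicator {1..} h \<partial>lborel)"
    by (intro nn_integral_add) auto
  also have "(\<integral>\<^sup>+h. ennreal (4 / h\<^sup>2) * indicator {1..} h \<partial>lborel) = ennreal (0 - (- 4 / 1))"
  proof (rule nn_integral_FTC_atLeast)
    show "((\<lambda>h::real. - 4 / h) \<longlongrightarrow> 0) at_top" by real_asymp
    show "((\<lambda>h. - 4 / h) has_real_derivative 4 / h\<^sup>2) (at h)" if "1 \<le> h" for h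
      using that by (auto intro!: derivative_eq_intros simp: power2_eq_square)
  qed auto
  finally show ?thesis by (simp add: le_less_trans ennreal_add_less_top[unfolded infinity_ennreal_def])
qed

text \<open>Homogeneity under \<open>h \<mapsto> \<bar>k\<bar> * h\<close>: the kernel contributes
  \<open>k^2\<close>, and the Jacobian takes back one power of \<open>\<bar>k\<bar>\<close>.\<close>

lemma increment_mass_scale:
  assumes k: "k \<noteq> 0"
  shows "(\<integral>\<^sup>+h. ennreal ((2 - 2 * cos (k * h)) / h\<^sup>2) * indicator {0<..} h \<partial>lborel) = ennreal \<bar>k\<bar> * increment_mass"
proof -
  have "(\<integral>\<^sup>+h. ennreal ((2 - 2 * cos (k * h)) / h\<^sup>2) * indicator {0<..} h \<partial>lborel) =
      (\<integral>\<^sup>+h. ennreal (k\<^sup>2) * (ennreal ((2 - 2 * cos (0 + \<bar>k\<bar> * h)) / (0 + \<bar>k\<bar> * h)\<^sup>2) * indicator {0<..} (0 + \<bar>k\<bar> * h)) \<partial>lborel)"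
  proof (intro nn_integral_cong)
    fix h
    have "cos (\<bar>k\<bar> * h) = cos (k * h)" by (cases "k \<ge> 0") auto
    then show "ennreal ((2 - 2 * cos (k * h)) / h\<^sup>2) * indicator {0<..} h =
      ennreal (k\<^sup>2) * (ennreal ((2 - 2 * cos (0 + \<bar>k\<bar> * h)) / (0 + \<bar>k\<bar> * h)\<^sup>2) * indicator {0<..} (0 + \<bar>k\<bar> * h))"
      using k by (auto split: split_indicator simp: ennreal_mult'[symmetric] power_mult_distrib zero_less_mult_iff)
  qed
  also have "\<dots> = ennreal \<bar>k\<bar> * (ennreal \<bar>\<bar>k\<bar>\<bar> * (\<integral>\<^sup>+h. ennreal ((2 - 2 * cos (0 + \<bar>k\<bar> * h)) / (0 + \<bar>k\<bar> * h)\<^sup>2) * indicator {0<..} (0 + \<bar>k\<bar> * h) \<partial>lborel))"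
    by (subst nn_integral_cmult) (auto simp: power2_eq_square ennreal_mult'[symmetric] mult.assoc[symmetric] simp flip: abs_mult)
  also have "\<dots> = ennreal \<bar>k\<bar> * increment_mass"
    unfolding increment_mass_def using k
    by (subst nn_integral_real_affine[where c="\<bar>k\<bar>" and t=0 and f="\<lambda>h. ennreal ((2 - 2 * cos h) / h\<^sup>2) * indicator {0<..} h"]) auto
  finally show ?thesis .
qed

text \<open>Half of the symmetric Gagliardo double integral of order 1/2: restricting to
  \<open>x < x'\<close> lets all increments have positive step \<open>h = x' - x\<close>.\<close>

definition energy :: "(real \<Rightarrow> complex) \<Rightarrow> ennreal" where
  "energy G = (\<integral>\<^sup>+x. (\<integral>\<^sup>+x'. ennreal ((cmod (G x' - G x))\<^sup>2 / (x' - x)\<^sup>2) * indicator {x<..} x' \<partial>lborel) \<partial>lborel)"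

lemma energy_increments:
  assumes [measurable]: "G \<in> borel_measurable borel"
  shows "energy G = (\<integral>\<^sup>+h. (\<integral>\<^sup>+x. ennreal ((cmod (G (x + h) - G x))\<^sup>2) \<partial>lborel) * (ennreal (1 / h\<^sup>2) * indicator {0<..} h) \<partial>lborel)"
proof -
  have "energy G = (\<integral>\<^sup>+x. (\<integral>\<^sup>+h. ennreal ((cmod (G (x + h) - G x))\<^sup>2) * (ennreal (1 / h\<^sup>2) * indicator {0<..} h) \<partial>lborel) \<partial>lborel)"
    unfolding energy_def
  proof (rule nn_integral_cong)
    fix x
    show "(\<integral>\<^sup>+x'. ennreal ((cmod (G x' - G x))\<^sup>2 / (x' - x)\<^sup>2) * indicator {x<..} x' \<partial>lborel) =
      (\<integral>\<^sup>+h. ennreal ((cmod (G (x + h) - G x))\<^sup>2) * (ennreal (1 / h\<^sup>2) * indicator {0<..} h) \<partial>lborel)"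
      by (subst nn_integral_real_affine[where c=1 and t=x])
        (auto intro!: nn_integral_cong split: split_indicator simp: ennreal_mult'[symmetric])
  qed
  also have "\<dots> = (\<integral>\<^sup>+h. (\<integral>\<^sup>+x. ennreal ((cmod (G (x + h) - G x))\<^sup>2) * (ennreal (1 / h\<^sup>2) * indicator {0<..} h) \<partial>lborel) \<partial>lborel)"
    by (rule lborel_pair.Fubini'[symmetric]) measurable
  also have "\<dots> = (\<integral>\<^sup>+h. (\<integral>\<^sup>+x. ennreal ((cmod (G (x + h) - G x))\<^sup>2) \<partial>lborel) * (ennreal (1 / h\<^sup>2) * indicator {0<..} h) \<partial>lborel)"
    by (intro nn_integral_cong nn_integral_multc) measurable
  finally show ?thesis .
qed

text \<open>Apply \<open>parseval_increment\<close> for each step \<open>h\<close> and exchange the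
  integrals. The integral over \<open>h\<close> yields
  \<open>\<bar>k\<bar> * increment_mass\<close>, which turns the weight \<open>1 / k^2\<close> into
  \<open>1 / \<bar>k\<bar>\<close>.\<close>

lemma energy_cumul:
  assumes f: "integrable lborel f" and \<xi>[measurable]: "\<xi> \<in> borel_measurable borel" and inj: "inj \<xi>"
  shows "ennreal (2 * pi) * energy (cumul \<xi> f) = increment_mass * (\<integral>\<^sup>+k. ennreal ((cmod (ctrans \<xi> f k))\<^sup>2 / \<bar>k\<bar>) \<partial>lborel)"
proof -
  have [measurable]: "cumul \<xi> f \<in> borel_measurable borel"
    using continuous_cumul[OF f \<xi> inj] by (rule borel_measurable_continuous_onI)
  have [measurable]: "ctrans \<xi> f \<in> borel_measurable borel" using f \<xi> by (rule ctrans_measurable)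
  let ?P = "\<lambda>k. (cmod (ctrans \<xi> f k))\<^sup>2"
  have "ennreal (2 * pi) * energy (cumul \<xi> f) =
    (\<integral>\<^sup>+h. ennreal (2 * pi) * (\<integral>\<^sup>+x. ennreal ((cmod (cumul \<xi> f (x + h) - cumul \<xi> f x))\<^sup>2) \<partial>lborel) * (ennreal (1 / h\<^sup>2) * indicator {0<..} h) \<partial>lborel)"
    unfolding energy_increments[OF \<open>cumul \<xi> f \<in> borel_measurable borel\<close>] mult.assoc
    by (rule nn_integral_cmult[symmetric]) measurable
  also have "\<dots> = (\<integral>\<^sup>+h. (\<integral>\<^sup>+k. ennreal (?P k * (2 - 2 * cos (k * h)) / k\<^sup>2) \<partial>lborel) * (ennreal (1 / h\<^sup>2) * indicator {0<..} h) \<partial>lborel)"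
    by (intro nn_integral_cong) (auto split: split_indicator simp: parseval_increment[OF f \<xi> inj])
  also have "\<dots> = (\<integral>\<^sup>+h. (\<integral>\<^sup>+k. ennreal (?P k * (2 - 2 * cos (k * h)) / k\<^sup>2) * (ennreal (1 / h\<^sup>2) * indicator {0<..} h) \<partial>lborel) \<partial>lborel)"
    by (intro nn_integral_cong nn_integral_multc[symmetric]) measurable
  also have "\<dots> = (\<integral>\<^sup>+k. (\<integral>\<^sup>+h. ennreal (?P k * (2 - 2 * cos (k * h)) / k\<^sup>2) * (ennreal (1 / h\<^sup>2) * indicator {0<..} h) \<partial>lborel) \<partial>lborel)"
    by (rule lborel_pair.Fubini') measurable
  also have "\<dots> = (\<integral>\<^sup>+k. increment_mass * ennreal (?P k / \<bar>k\<bar>) \<partial>lborel)"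
  proof (rule nn_integral_cong_AE)
    show "AE k in lborel. (\<integral>\<^sup>+h. ennreal (?P k * (2 - 2 * cos (k * h)) / k\<^sup>2) * (ennreal (1 / h\<^sup>2) * indicator {0<..} h) \<partial>lborel) = increment_mass * ennreal (?P k / \<bar>k\<bar>)"
      using AE_lborel_singleton[of 0]
    proof eventually_elim
      case (elim k)
      have "(\<integral>\<^sup>+h. ennreal (?P k * (2 - 2 * cos (k * h)) / k\<^sup>2) * (ennreal (1 / h\<^sup>2) * indicator {0<..} h) \<partial>lborel) =
        (\<integral>\<^sup>+h. ennreal (?P k / k\<^sup>2) * (ennreal ((2 - 2 * cos (k * h)) / h\<^sup>2) * indicator {0<..} h) \<partial>lborel)"
        by (intro nn_integral_cong) (auto split: split_indicator simp: ennreal_mult'[symmetric])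
      also have "\<dots> = ennreal (?P k / k\<^sup>2) * (ennreal \<bar>k\<bar> * increment_mass)"
        by (subst nn_integral_cmult) (auto simp: increment_mass_scale[OF elim])
      also have "\<dots> = increment_mass * ennreal (?P k / \<bar>k\<bar>)"
        using elim by (simp add: mult.assoc[symmetric] ennreal_mult'[symmetric] mult.commute[of increment_mass])
          (simp add: power2_eq_square abs_if)
      finally show ?case .
    qed
  qed
  also have "\<dots> = increment_mass * (\<integral>\<^sup>+k. ennreal (?P k / \<bar>k\<bar>) \<partial>lborel)"
    by (rule nn_integral_cmult) measurable
  finally show ?thesis .
qed

text \<open>As \<open>f\<close> has mean zero, its primitive tends to 0 at infinity, so increments
  with growing step converge to minus the primitive. Fatou and \<open>parseval_increment\<close>
  then give the bound; the 4 comes from \<open>2 - 2 * cos t \<le> 4\<close>.\<close>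

lemma nn_integral_cumul_le:
  assumes f: "integrable lborel f" and f0: "integral\<^sup>L lborel f = 0"
  shows "ennreal (2 * pi) * (\<integral>\<^sup>+x. ennreal ((cmod (cumul (\<lambda>x. x) f x))\<^sup>2) \<partial>lborel) \<le>
    4 * (\<integral>\<^sup>+k. ennreal ((cmod (ctrans (\<lambda>x. x) f k))\<^sup>2 / k\<^sup>2) \<partial>lborel)"
proof -
  let ?G = "cumul (\<lambda>x. x) f"
  have [measurable]: "f \<in> borel_measurable borel" using f by auto
  have [measurable]: "?G \<in> borel_measurable borel"
    using continuous_cumul[OF f, of "\<lambda>x. x"] by (intro borel_measurable_continuous_onI) auto
  have [measurable]: "ctrans (\<lambda>x. x) f \<in> borel_measurable borel" using f by (intro ctrans_measurable) auto
  have inv: "ennreal (1 / (2 * pi)) * ennreal (2 * pi) = 1"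
    by (simp flip: ennreal_mult')
  have lim: "(\<lambda>n. ?G (x + real (Suc n))) \<longlonglongrightarrow> 0" for x
  proof -
    have "(\<lambda>n. ?G (x + real (Suc n))) \<longlonglongrightarrow> integral\<^sup>L lborel f"
      unfolding cumul_def
    proof (rule integral_dominated_convergence[where w="\<lambda>y. norm (f y)"])
      show "AE y in lborel. (\<lambda>n. f y * indicator {..x + real (Suc n)} y) \<longlonglongrightarrow> f y"
      proof (intro AE_I2 tendsto_eventually)
        fix y
        show "\<forall>\<^sub>F n in sequentially. f y * indicator {..x + real (Suc n)} y = f y"
          using eventually_ge_at_top[of "nat \<lceil>y - x\<rceil>"]
        proof eventually_elim
          case (elim n)
          then have "y \<le> x + real (Suc n)" by linarith
          then show ?case by simp
        qed
      qed
    qed (use f in \<open>auto simp: norm_mult split: split_indicator\<close>)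
    then show ?thesis using f0 by simp
  qed
  have "(\<integral>\<^sup>+x. ennreal ((cmod (?G x))\<^sup>2) \<partial>lborel) = (\<integral>\<^sup>+x. liminf (\<lambda>n. ennreal ((cmod (?G (x + real (Suc n)) - ?G x))\<^sup>2)) \<partial>lborel)"
  proof (rule nn_integral_cong)
    fix x
    have "(\<lambda>n. (cmod (?G (x + real (Suc n)) - ?G x))\<^sup>2) \<longlonglongrightarrow> (cmod (0 - ?G x))\<^sup>2"
      by (intro tendsto_intros lim)
    then have "(\<lambda>n. ennreal ((cmod (?G (x + real (Suc n)) - ?G x))\<^sup>2)) \<longlonglongrightarrow> ennreal ((cmod (?G x))\<^sup>2)"
      by (intro tendsto_ennrealI) simp
    then show "ennreal ((cmod (?G x))\<^sup>2) = liminf (\<lambda>n. ennreal ((cmod (?G (x + real (Suc n)) - ?G x))\<^sup>2))"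
      by (rule lim_imp_Liminf[OF sequentially_bot, symmetric])
  qed
  also have "\<dots> \<le> liminf (\<lambda>n. \<integral>\<^sup>+x. ennreal ((cmod (?G (x + real (Suc n)) - ?G x))\<^sup>2) \<partial>lborel)"
    by (rule nn_integral_liminf) measurable
  also have "\<dots> \<le> ennreal (1 / (2 * pi)) * (4 * (\<integral>\<^sup>+k. ennreal ((cmod (ctrans (\<lambda>x. x) f k))\<^sup>2 / k\<^sup>2) \<partial>lborel))"
  proof (intro Liminf_le always_eventually allI)
    fix n
    have "ennreal (2 * pi) * (\<integral>\<^sup>+x. ennreal ((cmod (?G (x + real (Suc n)) - ?G x))\<^sup>2) \<partial>lborel) =
      (\<integral>\<^sup>+k. ennreal ((cmod (ctrans (\<lambda>x. x) f k))\<^sup>2 * (2 - 2 * cos (k * real (Suc n))) / k\<^sup>2) \<partial>lborel)"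
      using f by (intro parseval_increment) auto
    also have "\<dots> \<le> (\<integral>\<^sup>+k. 4 * ennreal ((cmod (ctrans (\<lambda>x. x) f k))\<^sup>2 / k\<^sup>2) \<partial>lborel)"
    proof (rule nn_integral_mono)
      fix k
      have "(cmod (ctrans (\<lambda>x. x) f k))\<^sup>2 * (2 - 2 * cos (k * real (Suc n))) / k\<^sup>2 \<le> (cmod (ctrans (\<lambda>x. x) f k))\<^sup>2 * 4 / k\<^sup>2"
      proof (intro divide_right_mono mult_left_mono)
        show "2 - 2 * cos (k * real (Suc n)) \<le> 4"
          using cos_ge_minus_one[of "k * real (Suc n)"] by linarith
      qed auto
      then have "ennreal ((cmod (ctrans (\<lambda>x. x) f k))\<^sup>2 * (2 - 2 * cos (k * real (Suc n))) / k\<^sup>2) \<le> ennreal (4 * ((cmod (ctrans (\<lambda>x. x) f k))\<^sup>2 / k\<^sup>2))"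
        by (intro ennreal_leI) (simp add: mult_ac)
      then show "ennreal ((cmod (ctrans (\<lambda>x. x) f k))\<^sup>2 * (2 - 2 * cos (k * real (Suc n))) / k\<^sup>2) \<le> 4 * ennreal ((cmod (ctrans (\<lambda>x. x) f k))\<^sup>2 / k\<^sup>2)"
        by (simp only: ennreal_mult' ennreal_numeral zero_le_numeral)
    qed
    also have "\<dots> = 4 * (\<integral>\<^sup>+k. ennreal ((cmod (ctrans (\<lambda>x. x) f k))\<^sup>2 / k\<^sup>2) \<partial>lborel)"
      by (rule nn_integral_cmult) measurable
    finally have "ennreal (1 / (2 * pi)) * (ennreal (2 * pi) * (\<integral>\<^sup>+x. ennreal ((cmod (?G (x + real (Suc n)) - ?G x))\<^sup>2) \<partial>lborel)) \<le>
      ennreal (1 / (2 * pi)) * (4 * (\<integral>\<^sup>+k. ennreal ((cmod (ctrans (\<lambda>x. x) f k))\<^sup>2 / k\<^sup>2) \<partial>lborel))"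
      by (rule mult_left_mono) simp
    then show "(\<integral>\<^sup>+x. ennreal ((cmod (?G (x + real (Suc n)) - ?G x))\<^sup>2) \<partial>lborel) \<le>
      ennreal (1 / (2 * pi)) * (4 * (\<integral>\<^sup>+k. ennreal ((cmod (ctrans (\<lambda>x. x) f k))\<^sup>2 / k\<^sup>2) \<partial>lborel))"
      by (simp only: mult.assoc[symmetric] inv mult_1_left)
  qed simp
  finally have "ennreal (2 * pi) * (\<integral>\<^sup>+x. ennreal ((cmod (?G x))\<^sup>2) \<partial>lborel) \<le>
    ennreal (2 * pi) * (ennreal (1 / (2 * pi)) * (4 * (\<integral>\<^sup>+k. ennreal ((cmod (ctrans (\<lambda>x. x) f k))\<^sup>2 / k\<^sup>2) \<partial>lborel)))"
    by (rule mult_left_mono) simp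
  also have "\<dots> = (ennreal (2 * pi) * ennreal (1 / (2 * pi))) * (4 * (\<integral>\<^sup>+k. ennreal ((cmod (ctrans (\<lambda>x. x) f k))\<^sup>2 / k\<^sup>2) \<partial>lborel))"
    by (rule mult.assoc[symmetric])
  also have "ennreal (2 * pi) * ennreal (1 / (2 * pi)) = 1"
    using inv by (simp only: mult.commute)
  finally show ?thesis by simp
qed

section \<open>Analysis of \<open>xmap\<close>: kernel estimate, Hardy weight and change of
  variables\<close>

lemma xmap_deriv: "(xmap has_real_derivative 1 / (1 + exp y)) (at y)"
proof -
  have [simp]: "1 + exp y > 0" "1 + exp (- y) > 0" by (simp_all add: add_pos_pos)
  have "(xmap has_real_derivative exp (- y) / (1 + exp (- y))) (at y)"
    unfolding xmap_def[abs_def] by (auto intro!: derivative_eq_intros)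
  also have "exp (- y) / (1 + exp (- y)) = 1 / (1 + exp y)"
    by (simp add: exp_minus field_simps)
  finally show ?thesis .
qed

lemma xmap_strict_mono: "strict_mono xmap"
  unfolding strict_mono_def xmap_def by (auto simp: add_pos_pos)

lemma xmap_less_iff: "xmap a < xmap b \<longleftrightarrow> a < b" and xmap_le_iff: "xmap a \<le> xmap b \<longleftrightarrow> a \<le> b"
  using xmap_strict_mono by (simp_all add: strict_mono_less strict_mono_less_eq)

lemma xmap_neg: "xmap y < 0"
  unfolding xmap_def by (simp add: ln_gt_zero)

lemma xmap_measurable [measurable]: "xmap \<in> borel_measurable borel"
  unfolding xmap_def[abs_def] by measurable

lemma xmap_inverse:
  assumes "x < 0" shows "xmap (- ln (exp (- x) - 1)) = x"
  using assms by (simp add: xmap_def)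

text \<open>Expressing both \<open>y\<close> and \<open>xmap y\<close> through \<open>sqrt (xmap' y)\<close> reduces the kernel and Hardy estimates
  for \<^term>\<open>xmap\<close> to \<open>ln t \<le> t - 1\<close>.\<close>
lemma xmap_sqrt_deriv:
  defines "a \<equiv> \<lambda>y::real. sqrt (1 / (1 + exp y))"
  shows "0 < a y" "(a y)\<^sup>2 = 1 / (1 + exp y)" "(a y)\<^sup>2 < 1"
    and "xmap y = ln (1 - (a y)\<^sup>2)" "y = xmap y - 2 * ln (a y)"
proof -
  have pos: "1 + exp y > 0" by (simp add: add_pos_pos)
  show "0 < a y" using pos by (simp add: a_def)
  show sq: "(a y)\<^sup>2 = 1 / (1 + exp y)" using pos by (simp add: a_def)
  show "(a y)\<^sup>2 < 1" unfolding sq using pos by simp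
  have "1 - (a y)\<^sup>2 = inverse (1 + exp (- y))"
    unfolding sq using pos by (simp add: exp_minus field_simps)
  then show "xmap y = ln (1 - (a y)\<^sup>2)"
    by (simp add: xmap_def ln_inverse add_pos_pos)
  have "2 * ln (a y) = ln ((a y)\<^sup>2)"
    using \<open>0 < a y\<close> by (simp add: ln_realpow)
  also have "\<dots> = - ln (1 + exp y)" unfolding sq using pos by (simp add: ln_div)
  also have "1 + exp y = exp y * (1 + exp (- y))" by (simp add: exp_minus field_simps)
  also have "- ln (exp y * (1 + exp (- y))) = xmap y - y"
    using add_pos_pos[OF zero_less_one exp_gt_zero[of "- y"]] by (subst ln_mult) (auto simp: xmap_def)
  finally show "y = xmap y - 2 * ln (a y)" by simp
qed

text \<open>With \<open>a\<close>, \<open>b\<close> the square roots of the derivatives at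
  \<open>y\<close>, \<open>z\<close> and \<open>L = xmap z - xmap y\<close>, this is the square of
  \<open>a * b * (z - y) \<le> 3 * L\<close>. Here \<open>z - y = L + 2 * ln (a / b)\<close>; the
  first term costs one \<open>L\<close> since \<open>a\<close> and \<open>b\<close> are below 1, and
  the second costs two, since \<open>a * b * (a / b - 1) = a * (a - b) \<le> L\<close>.\<close>

lemma xmap_kernel_le:
  assumes "y < z"
  shows "1 / (1 + exp y) * (1 / (1 + exp z)) / (xmap z - xmap y)\<^sup>2 \<le> 9 / (z - y)\<^sup>2"
proof -
  define a where "a = sqrt (1 / (1 + exp y))"
  define b where "b = sqrt (1 / (1 + exp z))"
  note A = xmap_sqrt_deriv[of y, folded a_def]
  note B = xmap_sqrt_deriv[of z, folded b_def]
  let ?L = "xmap z - xmap y"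
  have L: "?L > 0" using assms by (simp add: xmap_less_iff)
  have ba: "b < a" using assms by (simp add: a_def b_def frac_less2 add_pos_pos)
  have a1: "a < 1" "b < 1" using A(3) B(3) power2_less_imp_less[of _ "1::real"] by (simp_all del: A B)
  have "?L = ln ((1 - b\<^sup>2) / (1 - a\<^sup>2))" using A B by (simp add: ln_div)
  \<comment> \<open>Passing to the reciprocal quotient makes \<open>ln t \<le> t - 1\<close> a lower
    bound for \<open>?L\<close>.\<close>
  also have "\<dots> = - ln ((1 - a\<^sup>2) / (1 - b\<^sup>2))" using A B by (simp add: ln_div)
  also have "\<dots> \<ge> 1 - (1 - a\<^sup>2) / (1 - b\<^sup>2)"
    using ln_le_minus_one[of "(1 - a\<^sup>2) / (1 - b\<^sup>2)"] A B by simp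
  also have "1 - (1 - a\<^sup>2) / (1 - b\<^sup>2) = (a\<^sup>2 - b\<^sup>2) / (1 - b\<^sup>2)"
    using B by (simp add: field_simps)
  finally have L1: "(a\<^sup>2 - b\<^sup>2) / (1 - b\<^sup>2) \<le> ?L" .
  have "a * (a - b) \<le> (a + b) * (a - b)" using A B ba by (intro mult_right_mono) auto
  also have "\<dots> = (a\<^sup>2 - b\<^sup>2) / 1" by (simp add: power2_eq_square algebra_simps)
  also have "\<dots> \<le> (a\<^sup>2 - b\<^sup>2) / (1 - b\<^sup>2)"
  proof (rule divide_left_mono)
    show "0 \<le> a\<^sup>2 - b\<^sup>2" using power_mono[of b a 2] ba B(1) by simp
  qed (use B(3) in simp_all)
  also note L1
  finally have L2: "a * (a - b) \<le> ?L" .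
  have "z - y = ?L + 2 * ln (a / b)" using A B by (simp add: ln_div)
  also have "\<dots> \<le> ?L + 2 * (a / b - 1)" using ln_le_minus_one[of "a/b"] A B by simp
  finally have "(a * b) * (z - y) \<le> (a * b) * (?L + 2 * (a / b - 1))"
    using A B by (intro mult_left_mono) auto
  also have "\<dots> = (a * b) * ?L + 2 * (a * (a - b))" using B by (simp add: field_simps)
  also have "\<dots> \<le> 1 * ?L + 2 * ?L"
    using L2 L A B a1 by (intro add_mono mult_right_mono mult_le_one mult_left_mono) auto
  finally have "(a * b) * (z - y) \<le> 3 * ?L" by simp
  then have "((a * b) * (z - y))\<^sup>2 \<le> (3 * ?L)\<^sup>2"
    using A B assms by (intro power_mono) auto
  then have sq: "a\<^sup>2 * b\<^sup>2 * (z - y)\<^sup>2 \<le> 9 * ?L\<^sup>2"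
    unfolding power_mult_distrib by simp
  have "a\<^sup>2 * b\<^sup>2 / ?L\<^sup>2 \<le> 9 / (z - y)\<^sup>2"
  proof -
    have "x / l \<le> 9 / d" if "x * d \<le> 9 * l" "l > 0" "d > 0" for x l d :: real
      using that by (simp add: field_simps)
    then show ?thesis using sq L assms by simp
  qed
  then show ?thesis by (simp only: A(2) B(2))
qed

text \<open>By \<open>ln t \<le> t - 1\<close>, \<open>- xmap y = - ln (1 - d) \<ge> d\<close> with
  \<open>d = 1 / (1 + exp y)\<close> the derivative. The quotient is the weight left over once one
  point of the kernel is integrated over \<open>{0..}\<close>.\<close>

lemma xmap_hardy_le: "1 / (1 + exp y) / (- xmap y) \<le> 1"
proof -
  note A = xmap_sqrt_deriv[of y]
  have "xmap y \<le> - (1 / (1 + exp y))"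
    using ln_le_minus_one[of "1 - (sqrt (1 / (1 + exp y)))\<^sup>2"] A(2,3) unfolding A(4) by simp
  then show ?thesis using xmap_neg[of y] by (subst divide_le_eq_1_pos) linarith+
qed

text \<open>\<open>xmap\<close> maps the line increasingly onto the negative half-line. The
  substitution is made on compact intervals, with \<open>Suc n\<close> keeping them nondegenerate,
  and both sides pass to the limit by monotone convergence, so infinite values are allowed.\<close>

lemma nn_integral_xmap:
  fixes H :: "real \<Rightarrow> ennreal"
  assumes [measurable]: "H \<in> borel_measurable borel"
  shows "(\<integral>\<^sup>+x. H x * indicator {..<0} x \<partial>lborel) = (\<integral>\<^sup>+y. H (xmap y) * ennreal (1 / (1 + exp y)) \<partial>lborel)"
proof (rule LIMSEQ_unique)
  let ?I = "\<lambda>n. {xmap (- real (Suc n))..xmap (real (Suc n))}"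
  show "(\<lambda>n. \<integral>\<^sup>+x. H x * indicator (?I n) x \<partial>lborel) \<longlonglongrightarrow> (\<integral>\<^sup>+x. H x * indicator {..<0} x \<partial>lborel)"
  proof (rule nn_integral_LIMSEQ)
    show "incseq (\<lambda>n x. H x * indicator (?I n) x)"
    proof (intro incseq_SucI le_funI mult_left_mono)
      fix n x
      have "?I n \<subseteq> ?I (Suc n)" by (simp add: xmap_le_iff)
      then show "indicator (?I n) x \<le> (indicator (?I (Suc n)) x :: ennreal)" by (rule indicator_leI[OF subsetD])
    qed simp
    fix x
    show "(\<lambda>n. H x * indicator (?I n) x) \<longlonglongrightarrow> H x * indicator {..<0} x"
    proof (cases "x < 0")
      case True
      define y where "y = - ln (exp (- x) - 1)"
      have x: "x = xmap y" unfolding y_def using xmap_inverse[OF True] by simp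
      have "\<forall>\<^sub>F n in sequentially. H x * indicator (?I n) x = H x * indicator {..<0} x"
        using eventually_ge_at_top[of "nat \<lceil>\<bar>y\<bar>\<rceil>"]
      proof eventually_elim
        case (elim n)
        then have "- real (Suc n) \<le> y" "y \<le> real (Suc n)" by linarith+
        then show ?case unfolding x using xmap_neg by (simp add: xmap_le_iff del: of_nat_Suc)
      qed
      then show ?thesis by (rule tendsto_eventually)
    next
      case False
      then have "x \<notin> ?I n" for n using xmap_neg[of "real (Suc n)"] by auto
      then show ?thesis using False by simp
    qed
  qed measurable
  have "(\<integral>\<^sup>+x. H x * indicator (?I n) x \<partial>lborel) = (\<integral>\<^sup>+y. H (xmap y) * ennreal (1 / (1 + exp y)) * indicator {- real (Suc n)..real (Suc n)} y \<partial>lborel)" for n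
    by (rule nn_integral_substitution_aux)
      (auto intro!: xmap_deriv continuous_intros simp: add_pos_pos less_imp_le add_nonneg_eq_0_iff)
  moreover have "(\<lambda>n. \<integral>\<^sup>+y. H (xmap y) * ennreal (1 / (1 + exp y)) * indicator {- real (Suc n)..real (Suc n)} y \<partial>lborel) \<longlonglongrightarrow> (\<integral>\<^sup>+y. H (xmap y) * ennreal (1 / (1 + exp y)) \<partial>lborel)"
  proof (rule nn_integral_LIMSEQ)
    show "incseq (\<lambda>n y. H (xmap y) * ennreal (1 / (1 + exp y)) * indicator {- real (Suc n)..real (Suc n)} y)"
      by (intro incseq_SucI le_funI mult_left_mono indicator_leI) auto
    fix y
    have "\<forall>\<^sub>F n in sequentially. H (xmap y) * ennreal (1 / (1 + exp y)) * indicator {- real (Suc n)..real (Suc n)} y = H (xmap y) * ennreal (1 / (1 + exp y))"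
      using eventually_ge_at_top[of "nat \<lceil>\<bar>y\<bar>\<rceil>"]
    proof eventually_elim
      case (elim n)
      then have "- real (Suc n) \<le> y" "y \<le> real (Suc n)" by linarith+
      then show ?case by (simp del: of_nat_Suc)
    qed
    then show "(\<lambda>n. H (xmap y) * ennreal (1 / (1 + exp y)) * indicator {- real (Suc n)..real (Suc n)} y) \<longlonglongrightarrow> H (xmap y) * ennreal (1 / (1 + exp y))"
      by (rule tendsto_eventually)
  qed measurable
  ultimately show "(\<lambda>n. \<integral>\<^sup>+x. H x * indicator (?I n) x \<partial>lborel) \<longlonglongrightarrow> (\<integral>\<^sup>+y. H (xmap y) * ennreal (1 / (1 + exp y)) \<partial>lborel)"
    by simp
qed

section \<open>Transfer of the energy through \<open>xmap\<close>\<close>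

lemma cumul_xmap: "cumul xmap f (xmap y) = cumul (\<lambda>x. x) f y"
  unfolding cumul_def by (simp add: indicator_def xmap_le_iff)

lemma cumul_xmap_nonneg:
  assumes "x \<ge> 0" shows "cumul xmap f x = integral\<^sup>L lborel f"
proof -
  have "xmap y \<le> x" for y using xmap_neg[of y] assms by linarith
  then show ?thesis unfolding cumul_def by simp
qed

text \<open>Since \<open>G\<close> vanishes on \<open>{0..}\<close>, only \<open>x < 0\<close>
  contributes. Pairs of negative points are substituted in both variables and the kernel estimate
  gives the factor 9; pairs with \<open>x' \<ge> 0\<close> integrate to the Hardy term
  \<open>(cmod (G x))^2 / (- x)\<close>, which \<open>xmap_hardy_le\<close> controls.\<close>

lemma energy_xmap_le:
  assumes f: "integrable lborel f" and f0: "integral\<^sup>L lborel f = 0"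
  shows "energy (cumul xmap f) \<le> 9 * energy (cumul (\<lambda>x. x) f) + (\<integral>\<^sup>+y. ennreal ((cmod (cumul (\<lambda>x. x) f y))\<^sup>2) \<partial>lborel)"
proof -
  let ?G = "cumul xmap f" and ?g = "cumul (\<lambda>x. x) f"
  define K where "K G x x' = ennreal ((cmod (G x' - G x))\<^sup>2 / (x' - x)\<^sup>2) * indicator {x<..} x'" for G :: "real \<Rightarrow> complex" and x x'
  have [measurable]: "?G \<in> borel_measurable borel"
    using continuous_cumul[OF f xmap_measurable strict_mono_imp_inj_on[OF xmap_strict_mono]]
    by (rule borel_measurable_continuous_onI)
  have [measurable]: "?g \<in> borel_measurable borel"
    using continuous_cumul[OF f, of "\<lambda>x. x"] by (intro borel_measurable_continuous_onI) auto
  have Kmeas [measurable]: "case_prod (K G) \<in> borel_measurable (borel \<Otimes>\<^sub>M borel)" if [measurable]: "G \<in> borel_measurable borel" for G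
    unfolding K_def indicator_def greaterThan_def by measurable
  note [measurable] = Kmeas[of ?G] Kmeas[of ?g]
  have G0: "?G x = 0" if "x \<ge> 0" for x using cumul_xmap_nonneg[OF that] f0 by simp
  let ?w = "\<lambda>y::real. ennreal (1 / (1 + exp y))"
  \<comment> \<open>The inner integral for \<open>x < 0\<close>: the first summand collects
    \<open>x' < 0\<close> in the variable \<open>y'\<close>, the second collects
    \<open>x' \<ge> 0\<close>.\<close>
  define R where "R x = (\<integral>\<^sup>+y'. K ?G x (xmap y') * ?w y' \<partial>lborel) + ennreal ((cmod (?G x))\<^sup>2 / (- x))" for x
  have [measurable]: "R \<in> borel_measurable borel" unfolding R_def by measurable
  have w0: "0 \<le> 1 / (1 + exp y)" for y :: real by (simp add: add_nonneg_nonneg)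
  have inner: "(\<integral>\<^sup>+x'. K ?G x x' \<partial>lborel) = R x * indicator {..<0} x" for x
  proof (cases "x < 0")
    case True
    have "(\<integral>\<^sup>+x'. K ?G x x' \<partial>lborel) = (\<integral>\<^sup>+x'. K ?G x x' * indicator {..<0} x' + K ?G x x' * indicator {0..} x' \<partial>lborel)"
      by (intro nn_integral_cong) (auto split: split_indicator)
    also have "\<dots> = (\<integral>\<^sup>+x'. K ?G x x' * indicator {..<0} x' \<partial>lborel) + (\<integral>\<^sup>+x'. K ?G x x' * indicator {0..} x' \<partial>lborel)"
      by (intro nn_integral_add) measurable
    also have "(\<integral>\<^sup>+x'. K ?G x x' * indicator {..<0} x' \<partial>lborel) = (\<integral>\<^sup>+y'. K ?G x (xmap y') * ?w y' \<partial>lborel)"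
      by (rule nn_integral_xmap) measurable
    also have "(\<integral>\<^sup>+x'. K ?G x x' * indicator {0..} x' \<partial>lborel) =
        (\<integral>\<^sup>+x'. ennreal ((cmod (?G x))\<^sup>2 / (x' - x)\<^sup>2) * indicator {0..} x' \<partial>lborel)"
      using True by (intro nn_integral_cong) (auto simp: K_def G0 split: split_indicator)
    also have "\<dots> = ennreal (0 - - (cmod (?G x))\<^sup>2 / (0 - x))"
    proof (rule nn_integral_FTC_atLeast)
      show "((\<lambda>x'. - (cmod (?G x))\<^sup>2 / (x' - x)) \<longlongrightarrow> 0) at_top"
        by (rule real_tendsto_divide_at_top[OF tendsto_const]) real_asymp
      show "((\<lambda>x'. - (cmod (?G x))\<^sup>2 / (x' - x)) has_real_derivative (cmod (?G x))\<^sup>2 / (x' - x)\<^sup>2) (at x')" if "0 \<le> x'" for x'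
        using that True by (auto intro!: derivative_eq_intros simp: power2_eq_square)
    qed auto
    finally show ?thesis using True by (simp add: R_def)
  next
    case False
    \<comment> \<open>Here \<open>x' > x \<ge> 0\<close>, so both values of \<open>G\<close>
      vanish.\<close>
    then have "K ?G x x' = 0" for x' by (auto simp: K_def G0 split: split_indicator)
    then show ?thesis using False by simp
  qed
  have "energy ?G = (\<integral>\<^sup>+x. R x * indicator {..<0} x \<partial>lborel)"
    unfolding energy_def inner[symmetric] K_def ..
  also have "\<dots> = (\<integral>\<^sup>+y. R (xmap y) * ?w y \<partial>lborel)"
    by (rule nn_integral_xmap) measurable
  also have "\<dots> \<le> (\<integral>\<^sup>+y. (\<integral>\<^sup>+y'. 9 * K ?g y y' \<partial>lborel) + ennreal ((cmod (?g y))\<^sup>2) \<partial>lborel)"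
  proof (rule nn_integral_mono)
    fix y
    have "(\<integral>\<^sup>+y'. K ?G (xmap y) (xmap y') * ?w y' \<partial>lborel) * ?w y = (\<integral>\<^sup>+y'. K ?G (xmap y) (xmap y') * ?w y' * ?w y \<partial>lborel)"
      by (rule nn_integral_multc[symmetric]) measurable
    also have "\<dots> \<le> (\<integral>\<^sup>+y'. 9 * K ?g y y' \<partial>lborel)"
    proof (rule nn_integral_mono)
      fix y'
      show "K ?G (xmap y) (xmap y') * ?w y' * ?w y \<le> 9 * K ?g y y'"
      proof (cases "y < y'")
        case True
        let ?D = "(cmod (?g y' - ?g y))\<^sup>2"
        have "?D * (1 / (1 + exp y) * (1 / (1 + exp y')) / (xmap y' - xmap y)\<^sup>2) \<le> ?D * (9 / (y' - y)\<^sup>2)"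
          using xmap_kernel_le[OF True] by (intro mult_left_mono) auto
        then have "ennreal (?D / (xmap y' - xmap y)\<^sup>2 * (1 / (1 + exp y')) * (1 / (1 + exp y))) \<le> ennreal (9 * (?D / (y' - y)\<^sup>2))"
          by (intro ennreal_leI) (simp add: mult_ac)
        then have "ennreal (?D / (xmap y' - xmap y)\<^sup>2) * ?w y' * ?w y \<le> 9 * ennreal (?D / (y' - y)\<^sup>2)"
          by (simp only: ennreal_mult'' ennreal_mult' w0 zero_le_numeral ennreal_numeral)
        then show ?thesis using True by (simp add: K_def cumul_xmap xmap_less_iff)
      qed (simp add: K_def xmap_less_iff)
    qed
    finally have 1: "(\<integral>\<^sup>+y'. K ?G (xmap y) (xmap y') * ?w y' \<partial>lborel) * ?w y \<le> (\<integral>\<^sup>+y'. 9 * K ?g y y' \<partial>lborel)" .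
    have "(cmod (?g y))\<^sup>2 * (1 / (1 + exp y) / (- xmap y)) \<le> (cmod (?g y))\<^sup>2 * 1"
      by (intro mult_left_mono xmap_hardy_le) auto
    then have "ennreal ((cmod (?g y))\<^sup>2 / (- xmap y) * (1 / (1 + exp y))) \<le> ennreal ((cmod (?g y))\<^sup>2)"
      by (intro ennreal_leI) (simp add: mult_ac)
    then have 2: "ennreal ((cmod (?G (xmap y)))\<^sup>2 / (- xmap y)) * ?w y \<le> ennreal ((cmod (?g y))\<^sup>2)"
      using xmap_neg[of y] by (simp only: cumul_xmap ennreal_mult'' [symmetric] w0)
    show "R (xmap y) * ?w y \<le> (\<integral>\<^sup>+y'. 9 * K ?g y y' \<partial>lborel) + ennreal ((cmod (?g y))\<^sup>2)"
      unfolding R_def distrib_right by (rule add_mono[OF 1 2])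
  qed
  also have "\<dots> = (\<integral>\<^sup>+y. (\<integral>\<^sup>+y'. 9 * K ?g y y' \<partial>lborel) \<partial>lborel) + (\<integral>\<^sup>+y. ennreal ((cmod (?g y))\<^sup>2) \<partial>lborel)"
    by (rule nn_integral_add) measurable
  also have "(\<integral>\<^sup>+y. (\<integral>\<^sup>+y'. 9 * K ?g y y' \<partial>lborel) \<partial>lborel) = 9 * energy ?g"
  proof -
    have "(\<integral>\<^sup>+y'. 9 * K ?g y y' \<partial>lborel) = 9 * (\<integral>\<^sup>+y'. K ?g y y' \<partial>lborel)" for y
      by (rule nn_integral_cmult) measurable
    then show ?thesis
      unfolding energy_def K_def[symmetric] by (simp add: nn_integral_cmult)
  qed
  finally show ?thesis .
qed

section \<open>Fourier support, thermal weights and normalisations\<close>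

lemma FT_conv_ctrans: "FT f p = complex_of_real (1 / sqrt (2 * pi)) * ctrans (\<lambda>y. y) f (- p)"
  unfolding FT_def ctrans_def by (simp add: cis_conv_exp)

lemma checkFT_conv_ctrans: "checkFT f k = complex_of_real (1 / sqrt (2 * pi)) * ctrans xmap f k"
  unfolding checkFT_def ctrans_def by (simp add: cis_conv_exp)

text \<open>The transform is continuous and vanishes on one side of 0, hence also at 0, where its
  value is the integral of \<open>f\<close>.\<close>

lemma integral_eq_0_if_FT_supported:
  assumes f: "integrable lborel f" and supp: "\<And>p. p < 0 \<Longrightarrow> FT f p = 0"
  shows "integral\<^sup>L lborel f = 0"
proof -
  let ?P = "ctrans (\<lambda>y. y) f"
  have P0: "?P k = 0" if "k > 0" for k
    using supp[of "- k"] that by (simp add: FT_conv_ctrans)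
  have "(\<lambda>n. ?P (1 / real (Suc n))) \<longlonglongrightarrow> ?P 0"
    using continuous_on_tendsto_compose[OF continuous_ctrans[OF f], of "\<lambda>y. y" "\<lambda>n. 1 / real (Suc n)" 0 sequentially]
      LIMSEQ_Suc[OF lim_1_over_n] by simp
  moreover have "?P (1 / real (Suc n)) = 0" for n by (rule P0) simp
  ultimately have "?P 0 = 0" using LIMSEQ_unique[OF _ tendsto_const] by simp
  then show ?thesis by (simp add: ctrans_def)
qed

text \<open>With \<open>t = 2 * pi * p\<close>, the three bounds rest on
  \<open>1 - exp (- t) \<le> 1\<close>, \<open>1 - exp (- t) \<le> t\<close> and
  \<open>exp t + exp (- t) \<ge> 2\<close>. They serve the weight \<open>1 / p\<close> of the
  energy, the weight \<open>1 / p^2\<close> of the primitive and the thermal density, in this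
  order.\<close>

lemma thermal_weight_ge:
  assumes "p > 0"
  shows "1 \<le> 1 / (1 - exp (- 2 * pi * p))" "1 / (2 * pi * p) \<le> 1 / (1 - exp (- 2 * pi * p))"
    "1 / (exp (2 * pi * p) - 1) \<le> 1 / (1 - exp (- 2 * pi * p))"
proof -
  have *: "2 * pi * p > 0" using assms by simp
  then have pos: "0 < 1 - exp (- 2 * pi * p)" by simp
  show "1 \<le> 1 / (1 - exp (- 2 * pi * p))" using pos by simp
  show "1 / (2 * pi * p) \<le> 1 / (1 - exp (- 2 * pi * p))"
    using exp_ge_add_one_self[of "- 2 * pi * p"] pos by (intro divide_left_mono) (auto intro!: mult_pos_pos * assms)
  have "2 \<le> exp (2 * pi * p) + exp (- 2 * pi * p)"
    using exp_ge_add_one_self[of "- 2 * pi * p"] exp_ge_add_one_self[of "2 * pi * p"] by linarith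
  then have "1 - exp (- 2 * pi * p) \<le> exp (2 * pi * p) - 1" by simp
  then show "1 / (exp (2 * pi * p) - 1) \<le> 1 / (1 - exp (- 2 * pi * p))"
    using pos by (intro divide_left_mono) (auto intro!: mult_pos_pos)
qed

lemma NTh_le_Bnd: "NTh (2 * pi) f \<le> Bnd f"
  unfolding NTh_def Bnd_def
proof (intro nn_integral_mono)
  fix p :: real
  have "(cmod (FT f p))\<^sup>2 / (2 * p) * (1 / (exp (2 * pi * p) - 1)) \<le> (cmod (FT f p))\<^sup>2 / (2 * p) * (1 / (1 - exp (- 2 * pi * p)))" if "p > 0"
    using thermal_weight_ge(3)[OF that] that by (intro mult_left_mono) auto
  then show "ennreal ((cmod (FT f p))\<^sup>2 / (2 * p) / (exp (2 * pi * p) - 1)) * indicator {0<..} p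
     \<le> ennreal ((cmod (FT f p))\<^sup>2 / (2 * p) / (1 - exp (- 2 * pi * p))) * indicator {0<..} p"
    by (auto split: split_indicator intro!: ennreal_leI)
qed

text \<open>Reflection \<open>k = - p\<close> matches the opposite signs in \<open>ctrans\<close>
  and \<open>FT\<close>. The support condition removes \<open>k > 0\<close>, so the weight has to be
  compared on one half-line only; \<open>2 * pi\<close> comes from the normalisation of
  \<open>FT\<close>.\<close>

lemma Bnd_ge:
  assumes f: "integrable lborel f" and supp: "\<And>p. p < 0 \<Longrightarrow> FT f p = 0"
    and [measurable]: "w \<in> borel_measurable borel"
    and w: "\<And>p. p > 0 \<Longrightarrow> w (- p) \<le> c * (1 / (2 * p) / (1 - exp (- 2 * pi * p)))"
    and c: "c \<ge> 0"
  shows "(\<integral>\<^sup>+k. ennreal ((cmod (ctrans (\<lambda>y. y) f k))\<^sup>2 * w k) \<partial>lborel) \<le> ennreal (2 * pi * c) * Bnd f"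
proof -
  let ?P = "ctrans (\<lambda>y. y) f"
  have [measurable]: "?P \<in> borel_measurable borel" using f by (intro ctrans_measurable) auto
  have P0: "?P k = 0" if "k > 0" for k
    using supp[of "- k"] that by (simp add: FT_conv_ctrans)
  have FT2: "(cmod (FT f p))\<^sup>2 = (cmod (?P (- p)))\<^sup>2 / (2 * pi)" for p
    by (simp add: FT_conv_ctrans norm_mult norm_divide power_mult_distrib power_divide)
  have [measurable]: "FT f \<in> borel_measurable borel"
    unfolding FT_conv_ctrans[abs_def] by measurable
  have "(\<integral>\<^sup>+k. ennreal ((cmod (?P k))\<^sup>2 * w k) \<partial>lborel) = (\<integral>\<^sup>+p. ennreal ((cmod (?P (0 + (- 1) * p)))\<^sup>2 * w (0 + (- 1) * p)) \<partial>lborel)"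
    by (subst nn_integral_real_affine[where c="-1" and t=0]) auto
  also have "\<dots> \<le> (\<integral>\<^sup>+p. ennreal (2 * pi * c) * (ennreal ((cmod (FT f p))\<^sup>2 / (2 * p) / (1 - exp (- 2 * pi * p))) * indicator {0<..} p) \<partial>lborel)"
  proof (rule nn_integral_mono_AE)
    show "AE p in lborel. ennreal ((cmod (?P (0 + (- 1) * p)))\<^sup>2 * w (0 + (- 1) * p)) \<le>
      ennreal (2 * pi * c) * (ennreal ((cmod (FT f p))\<^sup>2 / (2 * p) / (1 - exp (- 2 * pi * p))) * indicator {0<..} p)"
      using AE_lborel_singleton[of 0]
    proof eventually_elim
      case (elim p)
      show ?case
      proof (cases "p > 0")
        case True
        have "(cmod (?P (- p)))\<^sup>2 * w (- p) \<le> (cmod (?P (- p)))\<^sup>2 * (c * (1 / (2 * p) / (1 - exp (- 2 * pi * p))))"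
          by (intro mult_left_mono w True) auto
        also have "\<dots> = (2 * pi * c) * ((cmod (FT f p))\<^sup>2 / (2 * p) / (1 - exp (- 2 * pi * p)))"
        proof -
          have "a * (c * (1 / (2 * p) / d)) = (2 * pi * c) * (a / (2 * pi) / (2 * p) / d)" for a d :: real
            by simp
          then show ?thesis unfolding FT2 .
        qed
        finally have "ennreal ((cmod (?P (- p)))\<^sup>2 * w (- p)) \<le> ennreal ((2 * pi * c) * ((cmod (FT f p))\<^sup>2 / (2 * p) / (1 - exp (- 2 * pi * p))))"
          by (rule ennreal_leI)
        then show ?thesis using True c by (simp add: ennreal_mult' del: times_divide_eq_left times_divide_eq_right divide_divide_eq_left)
      next
        case False
        then show ?thesis using elim P0[of "- p"] by simp
      qed
    qed
  qed
  also have "\<dots> = ennreal (2 * pi * c) * Bnd f"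
    unfolding Bnd_def by (rule nn_integral_cmult) measurable
  finally show ?thesis .
qed

text \<open>The integral over \<open>k < 0\<close> is added for free. The factor
  \<open>4 * pi\<close> collects \<open>2 * pi\<close> from the normalisation of
  \<open>checkFT\<close> and 2 from the measure \<open>dk / (2 * k)\<close>.\<close>

lemma Nbar_le:
  assumes f: "integrable lborel f"
  shows "ennreal (4 * pi) * Nbar f \<le> (\<integral>\<^sup>+k. ennreal ((cmod (ctrans xmap f k))\<^sup>2 / \<bar>k\<bar>) \<partial>lborel)"
proof -
  let ?Q = "ctrans xmap f"
  have [measurable]: "?Q \<in> borel_measurable borel" using f by (intro ctrans_measurable) auto
  have "Nbar f = (\<integral>\<^sup>+k. ennreal ((cmod (?Q k))\<^sup>2 / (2 * pi) / (2 * k)) * indicator {0<..} k \<partial>lborel)"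
    unfolding Nbar_def by (simp add: checkFT_conv_ctrans norm_mult norm_divide power_mult_distrib power_divide)
  then have "ennreal (4 * pi) * Nbar f = (\<integral>\<^sup>+k. ennreal (4 * pi) * (ennreal ((cmod (?Q k))\<^sup>2 / (2 * pi) / (2 * k)) * indicator {0<..} k) \<partial>lborel)"
    by (simp add: nn_integral_cmult)
  also have "\<dots> \<le> (\<integral>\<^sup>+k. ennreal ((cmod (?Q k))\<^sup>2 / \<bar>k\<bar>) \<partial>lborel)"
    by (intro nn_integral_mono) (auto split: split_indicator simp: ennreal_mult'[symmetric])
  finally show ?thesis .
qed

section \<open>Assembly of the estimates and choice of the constant\<close>

theorem theorem3:
  shows "\<exists>C>0. \<forall>f :: real \<Rightarrow> complex.
    integrable lborel f \<and> (\<forall>p<0. FT f p = 0) \<and> normalised f \<longrightarrow>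
      Nbar f \<le> ennreal C * Bnd f \<and>
      Nbar f \<le> NTh (2 * pi) f + ennreal C * Bnd f \<and>
      NTh (2 * pi) f \<le> Nbar f + ennreal C * Bnd f"
proof -
  define c where "c = enn2real increment_mass"
  have c: "increment_mass = ennreal c" "c > 0"
    using increment_mass_finite increment_mass_pos by (simp_all add: c_def enn2real_positive_iff)
  \<comment> \<open>The 9 is the kernel constant. The other term comes from the square norm of
    \<open>g\<close>: its contribution \<open>4 * (2 * pi * (4 * pi))\<close> is divided by
    \<open>4 * pi * c\<close>.\<close>
  define C where "C = 9 + 8 * pi / c"
  have C1: "C \<ge> 1" using c by (simp add: C_def add_increasing2)
  have main: "Nbar f \<le> ennreal C * Bnd f" if f: "integrable lborel f" and supp: "\<And>p. p < 0 \<Longrightarrow> FT f p = 0" for f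
  proof -
    let ?P = "ctrans (\<lambda>y. y) f" and ?Q = "ctrans xmap f"
    let ?I = "\<integral>\<^sup>+y. ennreal ((cmod (cumul (\<lambda>y. y) f y))\<^sup>2) \<partial>lborel"
    have f0: "integral\<^sup>L lborel f = 0" using integral_eq_0_if_FT_supported[OF f supp] .
    have B1: "(\<integral>\<^sup>+k. ennreal ((cmod (?P k))\<^sup>2 / \<bar>k\<bar>) \<partial>lborel) \<le> ennreal (2 * pi * 2) * Bnd f"
    proof -
      have "1 / \<bar>- p\<bar> \<le> 2 * (1 / (2 * p) / (1 - exp (- 2 * pi * p)))" if "p > 0" for p
        using divide_right_mono[OF thermal_weight_ge(1)[OF that], of p] that by (simp add: mult.commute)
      from Bnd_ge[OF f supp _ this] show ?thesis by simp
    qed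
    have B2: "(\<integral>\<^sup>+k. ennreal ((cmod (?P k))\<^sup>2 / k\<^sup>2) \<partial>lborel) \<le> ennreal (2 * pi * (4 * pi)) * Bnd f"
    proof -
      have "1 / (- p)\<^sup>2 \<le> (4 * pi) * (1 / (2 * p) / (1 - exp (- 2 * pi * p)))" if "p > 0" for p
      proof -
        have "1 / (- p)\<^sup>2 = 2 * pi / p * (1 / (2 * pi * p))" using that by (simp add: power2_eq_square)
        also have "\<dots> \<le> 2 * pi / p * (1 / (1 - exp (- 2 * pi * p)))"
          using that by (intro mult_left_mono thermal_weight_ge) auto
        also have "2 * pi / p * (1 / d) = (4 * pi) * (1 / (2 * p) / d)" for d by simp
        finally show ?thesis .
      qed
      from Bnd_ge[OF f supp _ this] show ?thesis by simp
    qed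
    \<comment> \<open>The factor \<open>c\<close> is kept on the left so that
      \<open>energy_cumul\<close> can be used in both directions: for \<open>xmap\<close> to reach
      the energy, and for the identity to leave it.\<close>
    have "ennreal (4 * pi * c) * Nbar f = ennreal c * (ennreal (4 * pi) * Nbar f)"
      using c by (simp add: ennreal_mult' mult_ac)
    also have "\<dots> \<le> ennreal c * (\<integral>\<^sup>+k. ennreal ((cmod (?Q k))\<^sup>2 / \<bar>k\<bar>) \<partial>lborel)"
      by (intro mult_left_mono Nbar_le f) auto
    also have "\<dots> = ennreal (2 * pi) * energy (cumul xmap f)"
      unfolding c(1)[symmetric] using f strict_mono_imp_inj_on[OF xmap_strict_mono]
      by (intro energy_cumul[symmetric]) auto
    also have "\<dots> \<le> ennreal (2 * pi) * (9 * energy (cumul (\<lambda>y. y) f) + ?I)"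
      by (intro mult_left_mono energy_xmap_le f f0) auto
    also have "\<dots> = 9 * (ennreal (2 * pi) * energy (cumul (\<lambda>y. y) f)) + ennreal (2 * pi) * ?I"
      by (simp add: distrib_left mult_ac)
    also have "ennreal (2 * pi) * energy (cumul (\<lambda>y. y) f) = ennreal c * (\<integral>\<^sup>+k. ennreal ((cmod (?P k))\<^sup>2 / \<bar>k\<bar>) \<partial>lborel)"
      unfolding c(1)[symmetric] using f by (intro energy_cumul) auto
    also have "9 * (ennreal c * (\<integral>\<^sup>+k. ennreal ((cmod (?P k))\<^sup>2 / \<bar>k\<bar>) \<partial>lborel)) + ennreal (2 * pi) * ?I \<le>
        9 * (ennreal c * (ennreal (2 * pi * 2) * Bnd f)) + 4 * (ennreal (2 * pi * (4 * pi)) * Bnd f)"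
      by (intro add_mono mult_left_mono B1 order_trans[OF nn_integral_cumul_le[OF f f0]] B2) auto
    also have "\<dots> = (ennreal 9 * ennreal c * ennreal (2 * pi * 2) + ennreal 4 * ennreal (2 * pi * (4 * pi))) * Bnd f"
      by (simp add: distrib_right mult.assoc)
    also have "ennreal 9 * ennreal c * ennreal (2 * pi * 2) + ennreal 4 * ennreal (2 * pi * (4 * pi)) = ennreal (9 * c * (2 * pi * 2) + 4 * (2 * pi * (4 * pi)))"
    proof -
      have "ennreal (9 * c * (2 * pi * 2)) = ennreal 9 * ennreal c * ennreal (2 * pi * 2)"
        by (subst ennreal_mult'', simp, subst ennreal_mult', simp, rule refl)
      moreover have "ennreal (4 * (2 * pi * (4 * pi))) = ennreal 4 * ennreal (2 * pi * (4 * pi))"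
        by (rule ennreal_mult') simp
      ultimately show ?thesis using c(2) by (subst ennreal_plus) simp_all
    qed
    also have "9 * c * (2 * pi * 2) + 4 * (2 * pi * (4 * pi)) = (4 * pi * c) * C"
      using c by (simp add: C_def field_simps)
    finally have le: "ennreal (4 * pi * c) * Nbar f \<le> ennreal (4 * pi * c * C) * Bnd f" .
    \<comment> \<open>\<open>Nbar f\<close> and \<open>Bnd f\<close> may be infinite, so the finite
      positive factor is cancelled by multiplying with its reciprocal.\<close>
    have "ennreal (1 / (4 * pi * c)) * (ennreal (4 * pi * c) * Nbar f) \<le> ennreal (1 / (4 * pi * c)) * (ennreal (4 * pi * c * C) * Bnd f)"
      using le by (rule mult_left_mono) simp
    moreover have "ennreal (1 / (4 * pi * c)) * ennreal (4 * pi * c) = 1" "ennreal (1 / (4 * pi * c)) * ennreal (4 * pi * c * C) = ennreal C"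
      using c by (simp_all flip: ennreal_mult')
    ultimately show ?thesis by (simp only: mult.assoc[symmetric] mult_1_left)
  qed
  \<comment> \<open>Both quantities are nonnegative and at most \<open>ennreal C * Bnd f\<close>,
    hence so is their difference in either direction; \<open>C \<ge> 1\<close> makes the same
    constant work for the thermal one.\<close>
  have "NTh (2 * pi) f \<le> ennreal C * Bnd f" for f
    using mult_right_mono[OF ennreal_leI[OF C1], of "Bnd f"] NTh_le_Bnd[of f] by simp
  moreover have "0 < C" using C1 by simp
  ultimately show ?thesis
    by (intro exI[of _ C]) (blast intro: main add_increasing add_increasing2 zero_le)
qed

end
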